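(* Let $X_1,X_2,\dots$ be i.i.d. $\mathcal N(\mu_0,\sigma_0^2)$ with $\sigma_0^2>0$, and let the eavesdropper be weak, i.e. have only the side information $s^E_i=\{z^{i-1}\}$ at time $i$. Then the secrecy rate-payoff triple $(R,R_s,\Pi)$ is achievable if and only if $$R_s>0\qquad\text{and}\qquad \Pi\le 1-2^{-2R}.$$
   Context: Setting. Alice observes an i.i.d. source sequence $X^n$, $X_i\sim\mathcal N(\mu_0,\sigma_0^2)$. Alice and Bob share a secret key $K$ uniform on $\{1,\dots,2^{nR_s}\}$, independent of $X^n$. A (possibly stochastic) encoder $f_n$, i.e. a kernel $p(m|x^n,k)$, produces a message $M\in\{1,\dots,2^{nR}\}$, sent noiselessly and seen by both Bob and Eve. Bob uses (possibly stochastic) decoders $g_i$, i.e. kernels $p(y_i|m,k)$, to produce real-valued $Y_i$, $i=1,\dots,n$ (his side information is the key $k$). Eve uses (possibly stochastic) decoders $t_i$, i.e. kernels $p(z_i|m,s^E_i)$, to produce real-valued $Z_i$, where $s^E_i$ is her side information at time $i$ and $z^{i-1}=(z_1,\dots,z_{i-1})$ are her own past outputs. Rates $R$ (communication) and $R_s$ (secret key) are nonnegative and in bits. Payoff: $\pi(x,y,z)=\frac{1}{\sigma_0^2}[(z-x)^2-(y-x)^2]$ and $\pi(x^n,y^n,z^n)=\frac1n\sum_{i=1}^n\pi(x_i,y_i,z_i)$. Achievability: $(R,R_s,\Pi)$ is achievable if, with $K\in\{1,\dots,2^{nR_s}\}$ and $M\in\{1,\dots,2^{nR}\}$, $$\lim_{n\to\infty}\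 \sup_{f_n,\{g_i\}_{i=1}^n}\ \inf_{\{t_i\}_{i=1}^n}\ \mathbb E\,\pi(X^n,Y^n,Z^n)\ \ge\ \Pi .$$
   Formalization: The case R_s = 0 with Π ≤ 0 is excluded: there the stated equivalence fails, since a constant message with Y_i = μ_0 gives nonnegative payoff against every eavesdropper, so such triples are achievable although R_s > 0 is violated. *)

theory Defs
  imports "HOL-Probability.Probability"
begin

text \<open>
  Time indices run over \<open>{..<n}\<close> instead of \<open>1, \<dots>, n\<close>; all alphabets of letters are the reals.
  A stochastic kernel from \<open>A\<close> to \<open>B\<close> is a measurable map from \<open>A\<close> to \<open>prob_algebra B\<close>.
\<close>

abbreviation block :: "nat \<Rightarrow> (nat \<Rightarrow> real) measure" where
  "block n \<equiv> PiM {..<n} (\<lambda>_. borel)"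

definition index_set :: "nat \<Rightarrow> real \<Rightarrow> nat set" where
  "index_set n r = {j. 1 \<le> j \<and> real j \<le> 2 powr (real n * r)}"

definition encoders ::
    "real \<Rightarrow> real \<Rightarrow> nat \<Rightarrow> ((nat \<Rightarrow> real) \<times> nat \<Rightarrow> nat measure) set" where
  "encoders R Rs n =
     (block n \<Otimes>\<^sub>M count_space (index_set n Rs)) \<rightarrow>\<^sub>M prob_algebra (count_space (index_set n R))"

definition bob_decoders ::
    "real \<Rightarrow> real \<Rightarrow> nat \<Rightarrow> (nat \<Rightarrow> nat \<times> nat \<Rightarrow> real measure) set" where
  "bob_decoders R Rs n =
     {g. \<forall>i<n. g i \<in> (count_space (index_set n R) \<Otimes>\<^sub>M count_space (index_set n Rs))
                     \<rightarrow>\<^sub>M prob_algebra borel}"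

text \<open>
  The weak eavesdropper sees only the message and her own past outputs; \<open>block i\<close> carries
  the outputs at the times before \<open>i\<close>.
\<close>

definition weak_eve_decoders ::
    "real \<Rightarrow> nat \<Rightarrow> (nat \<Rightarrow> nat \<times> (nat \<Rightarrow> real) \<Rightarrow> real measure) set" where
  "weak_eve_decoders R n =
     {t. \<forall>i<n. t i \<in> (count_space (index_set n R) \<Otimes>\<^sub>M block i) \<rightarrow>\<^sub>M prob_algebra borel}"

definition source :: "real \<Rightarrow> real \<Rightarrow> nat \<Rightarrow> (nat \<Rightarrow> real) measure" where
  "source \<mu> \<sigma> n = PiM {..<n} (\<lambda>_. density lborel (normal_density \<mu> \<sigma>))"

primrec eve_outputs ::
    "(nat \<Rightarrow> nat \<times> (nat \<Rightarrow> real) \<Rightarrow> real measure) \<Rightarrow> nat \<Rightarrow> nat \<Rightarrow> (nat \<Rightarrow> real) measure" where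
  "eve_outputs t m 0 = return (block 0) (\<lambda>_. undefined)"
| "eve_outputs t m (Suc i) =
     eve_outputs t m i \<bind> (\<lambda>z. distr (t i (m, z)) (block (Suc i)) (\<lambda>w. z(i := w)))"

definition joint_law ::
    "real \<Rightarrow> real \<Rightarrow> real \<Rightarrow> nat \<Rightarrow> ((nat \<Rightarrow> real) \<times> nat \<Rightarrow> nat measure) \<Rightarrow>
     (nat \<Rightarrow> nat \<times> nat \<Rightarrow> real measure) \<Rightarrow> (nat \<Rightarrow> nat \<times> (nat \<Rightarrow> real) \<Rightarrow> real measure) \<Rightarrow>
     ((nat \<Rightarrow> real) \<times> (nat \<Rightarrow> real) \<times> (nat \<Rightarrow> real)) measure" where
  "joint_law \<mu> \<sigma> Rs n f g t =
     do {
       x \<leftarrow> source \<mu> \<sigma> n;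
       k \<leftarrow> uniform_count_measure (index_set n Rs);
       m \<leftarrow> f (x, k);
       y \<leftarrow> PiM {..<n} (\<lambda>i. g i (m, k));
       z \<leftarrow> eve_outputs t m n;
       return (block n \<Otimes>\<^sub>M block n \<Otimes>\<^sub>M block n) (x, y, z)
     }"

definition payoff :: "real \<Rightarrow> real \<Rightarrow> real \<Rightarrow> real \<Rightarrow> real" where
  "payoff \<sigma> x y z = 1 / \<sigma>\<^sup>2 * ((z - x)\<^sup>2 - (y - x)\<^sup>2)"

definition block_payoff ::
    "real \<Rightarrow> nat \<Rightarrow> (nat \<Rightarrow> real) \<times> (nat \<Rightarrow> real) \<times> (nat \<Rightarrow> real) \<Rightarrow> real" where
  "block_payoff \<sigma> n = (\<lambda>(x, y, z). 1 / real n * (\<Sum>i<n. payoff \<sigma> (x i) (y i) (z i)))"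

text \<open>
  Outputs may have infinite second moment, so the expectation is taken in the extended reals,
  as expectation of the positive part minus expectation of the negative part (the Bochner integral
  would be 0 for a non-integrable payoff). The value of \<open>\<infinity> - \<infinity>\<close> is immaterial to the sup-inf
  in \<open>secrecy_value\<close>: it arises only if Bob's distortion is infinite, and then the
  infimum is \<open>-\<infinity>\<close> anyway, as a constant output of Eve shows.
\<close>

definition expectation_ereal :: "'a measure \<Rightarrow> ('a \<Rightarrow> real) \<Rightarrow> ereal" where
  "expectation_ereal P h =
     enn2ereal (\<integral>\<^sup>+\<omega>. ennreal (h \<omega>) \<partial>P) - enn2ereal (\<integral>\<^sup>+\<omega>. ennreal (- h \<omega>) \<partial>P)"

definition secrecy_value :: "real \<Rightarrow> real \<Rightarrow> real \<Rightarrow> real \<Rightarrow> nat \<Rightarrow> ereal" where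
  "secrecy_value \<mu> \<sigma> R Rs n =
     (SUP (f, g) \<in> encoders R Rs n \<times> bob_decoders R Rs n.
        INF t \<in> weak_eve_decoders R n.
          expectation_ereal (joint_law \<mu> \<sigma> Rs n f g t) (block_payoff \<sigma> n))"

definition achievable :: "real \<Rightarrow> real \<Rightarrow> real \<Rightarrow> real \<Rightarrow> real \<Rightarrow> bool" where
  "achievable \<mu> \<sigma> R Rs p \<longleftrightarrow>
     (\<exists>L. secrecy_value \<mu> \<sigma> R Rs \<longlonglongrightarrow> L \<and> ereal p \<le> L)"

end

theory Submission
  imports Defs "HOL-Real_Asymp.Real_Asymp"
begin

text \<open>
  Eve may always answer with the constant \<open>\<mu>\<^sub>0\<close>, which caps the payoff by one minus Bob's normalized
  distortion. The rate-distortion bound for Bob needs no entropies: with at most \<open>N = 2 powr (n R)\<close>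
  codewords \<open>b\<^sub>j\<close> and \<open>D = \<sigma>\<^sup>2 2 powr (- 2 R)\<close>, the likelihood ratio of the mixture \<open>1/N \<Sum>\<^sub>j \<N>(b\<^sub>j, D)\<close>
  against the source dominates \<open>exp u\<close> with \<open>u = \<bar>x - \<mu>\<bar>\<^sup>2 / (2 \<sigma>\<^sup>2) - min\<^sub>j \<bar>x - b\<^sub>j\<bar>\<^sup>2 / (2 D)\<close>, and \<open>exp u \<ge> 1 + u\<close>
  integrates to the claim. Without a key, Eve imitates Bob by the conditional means of his decoders.

  For achievability one bit of the key suffices in essence: Alice and Bob flip the sign of the centred
  source according to the parity of the key. The flipped source is independent of the key, hence Eve's
  best estimate stays \<open>\<mu>\<^sub>0\<close>, while Bob undoes the flip and uses an ordinary Gaussian codebook. Such a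
  codebook is found by covering typical sequences, with every typicality and covering estimate
  obtained from a change of measure between Gaussians.
\<close>

subsection \<open>Product Gaussian measures and change of measure\<close>

text \<open>One bit can protect a whole block because Eve is weak: she never sees a true source
  letter, and the message is a function of the flipped source alone, so nothing she holds is
  correlated with the sign, however long the block. True past letters, compared with the codeword,
  would give the sign away. Hence the size of a positive \<open>Rs\<close> does not matter;
  positivity only makes the number K of keys grow. When K is odd the two signs are not equally
  frequent: the mean sign is 1/K, and Eve's guaranteed distortion loses the fraction 1/K^2, which
  vanishes in the limit. Bob's and Eve's distortions are kept apart as nonnegative integrals, where
  monotonicity and exchange of integrals require no integrability proof. They are subtracted only
  once, when at least one of them is finite. Tail bounds, covering and the converse all rest on the
  single density ratio \<open>tilt\<close>; each use amounts to the fact that such a ratio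
  integrates to one.\<close>

definition gauss :: "(nat \<Rightarrow> real) \<Rightarrow> real \<Rightarrow> nat \<Rightarrow> (nat \<Rightarrow> real) measure" where
  "gauss c s n = PiM {..<n} (\<lambda>i. density lborel (normal_density (c i) s))"

lemma source_eq_gauss: "source \<mu> \<sigma> n = gauss (\<lambda>_. \<mu>) \<sigma> n"
  by (simp add: source_def gauss_def)

lemma sets_gauss [simp, measurable_cong]: "sets (gauss c s n) = sets (block n)"
  unfolding gauss_def by (intro sets_PiM_cong) auto

lemma space_gauss [simp]: "space (gauss c s n) = space (block n)"
  by (rule sets_eq_imp_space_eq) simp

lemma prob_space_gauss: "s > 0 \<Longrightarrow> prob_space (gauss c s n)"
  unfolding gauss_def by (intro prob_space_PiM prob_space_normal_density)

text \<open>Finite boxes determine the product measure, and on a box the integral of a product of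
  one-coordinate functions factorises.\<close>

lemma PiM_density:
  fixes M :: "'i \<Rightarrow> 'a measure" and f :: "'i \<Rightarrow> 'a \<Rightarrow> ennreal"
  assumes "finite I" "\<And>i. prob_space (M i)" "\<And>i. prob_space (density (M i) (f i))"
    and [measurable]: "\<And>i. f i \<in> borel_measurable (M i)"
  shows "PiM I (\<lambda>i. density (M i) (f i)) = density (PiM I M) (\<lambda>x. \<Prod>i\<in>I. f i (x i))"
proof -
  interpret M: product_prob_space M by (rule product_prob_spaceI) (rule assms)
  interpret D: product_prob_space "\<lambda>i. density (M i) (f i)"
    by (rule product_prob_spaceI) (rule assms)
  have "density (PiM I M) (\<lambda>x. \<Prod>i\<in>I. f i (x i)) = PiM I (\<lambda>i. density (M i) (f i))"
  proof (rule D.PiM_eqI)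
    show "sets (density (PiM I M) (\<lambda>x. \<Prod>i\<in>I. f i (x i))) = sets (PiM I (\<lambda>i. density (M i) (f i)))"
      by (simp cong: sets_PiM_cong)
    fix A assume A: "\<And>i. i \<in> I \<Longrightarrow> A i \<in> sets (density (M i) (f i))"
    then have [measurable]: "\<And>i. i \<in> I \<Longrightarrow> A i \<in> sets (M i)" by simp
    have *: "Pi\<^sub>E I A \<in> sets (PiM I M)"
      using assms(1) A by (intro sets_PiM_I_finite) auto
    have meas: "(\<lambda>x. \<Prod>i\<in>I. f i (x i)) \<in> borel_measurable (PiM I M)"
      by measurable
    have "emeasure (density (PiM I M) (\<lambda>x. \<Prod>i\<in>I. f i (x i))) (Pi\<^sub>E I A)
        = (\<integral>\<^sup>+x. (\<Prod>i\<in>I. f i (x i)) * indicator (Pi\<^sub>E I A) x \<partial>PiM I M)"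
      using * meas by (simp add: emeasure_density)
    also have "\<dots> = (\<integral>\<^sup>+x. (\<Prod>i\<in>I. f i (x i) * indicator (A i) (x i)) \<partial>PiM I M)"
    proof (intro nn_integral_cong)
      fix x assume "x \<in> space (PiM I M)"
      then have "indicator (Pi\<^sub>E I A) x = (\<Prod>i\<in>I. indicator (A i) (x i) :: ennreal)"
        using assms(1) by (auto simp: indicator_def space_PiM PiE_iff prod_zero_iff)
      then show "(\<Prod>i\<in>I. f i (x i)) * indicator (Pi\<^sub>E I A) x
          = (\<Prod>i\<in>I. f i (x i) * indicator (A i) (x i))"
        by (simp add: prod.distrib)
    qed
    also have "\<dots> = (\<Prod>i\<in>I. \<integral>\<^sup>+x. f i x * indicator (A i) x \<partial>M i)"
      using assms(1) by (intro M.product_nn_integral_prod) auto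
    also have "\<dots> = (\<Prod>i\<in>I. emeasure (density (M i) (f i)) (A i))"
      by (intro prod.cong refl) (simp add: emeasure_density)
    finally show "emeasure (density (PiM I M) (\<lambda>x. \<Prod>i\<in>I. f i (x i))) (Pi\<^sub>E I A)
        = (\<Prod>i\<in>I. emeasure (density (M i) (f i)) (A i))" .
  qed (rule assms)
  then show ?thesis by simp
qed

text \<open>The density of the Gaussian with mean vector d and deviation t relative to the one with
  mean vector c and deviation s. The means are vectors because codewords appear as means.\<close>

definition tilt :: "(nat \<Rightarrow> real) \<Rightarrow> real \<Rightarrow> (nat \<Rightarrow> real) \<Rightarrow> real \<Rightarrow> nat \<Rightarrow> (nat \<Rightarrow> real) \<Rightarrow> real" where
  "tilt c s d t n x =
     (s / t) ^ n * exp ((\<Sum>i<n. (x i - c i)\<^sup>2) / (2 * s\<^sup>2) - (\<Sum>i<n. (x i - d i)\<^sup>2) / (2 * t\<^sup>2))"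

lemma measurable_tilt [measurable]: "tilt c s d t n \<in> borel_measurable (block n)"
  unfolding tilt_def[abs_def] by measurable

lemma gauss_tilt:
  assumes "s > 0" "t > 0"
  shows "gauss d t n = density (gauss c s n) (\<lambda>x. ennreal (tilt c s d t n x))"
proof -
  let ?r = "\<lambda>i x. s / t * exp ((x - c i)\<^sup>2 / (2 * s\<^sup>2) - (x - d i)\<^sup>2 / (2 * t\<^sup>2))"
  have *: "density lborel (normal_density (d i) t)
      = density (density lborel (normal_density (c i) s)) (\<lambda>x. ennreal (?r i x))" for i
  proof -
    have "exp (- (x - d i)\<^sup>2 / (2 * t\<^sup>2)) = exp (- (x - c i)\<^sup>2 / (2 * s\<^sup>2))
        * exp ((x - c i)\<^sup>2 / (2 * s\<^sup>2) - (x - d i)\<^sup>2 / (2 * t\<^sup>2))" for x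
      by (simp flip: exp_add)
    then have "normal_density (d i) t x = normal_density (c i) s x * ?r i x" for x
      using assms unfolding normal_density_def by (simp add: real_sqrt_mult)
    then show ?thesis using assms
      by (subst density_density_eq) (auto simp: ennreal_mult[symmetric] intro!: density_cong)
  qed
  have "tilt c s d t n x = (\<Prod>i<n. ?r i (x i))" for x
    unfolding tilt_def prod.distrib prod_constant
    by (simp add: exp_sum[symmetric] sum_subtractf sum_divide_distrib)
  then have **: "ennreal (tilt c s d t n x) = (\<Prod>i<n. ennreal (?r i (x i)))" for x
    using assms by (simp add: prod_ennreal)
  show ?thesis
    unfolding gauss_def ** *
  proof (intro PiM_density)
    show "prob_space (density (density lborel (normal_density (c i) s)) (\<lambda>x. ennreal (?r i x)))" for i
      unfolding *[symmetric] using assms by (simp add: prob_space_normal_density)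
  qed (use assms in \<open>simp_all add: prob_space_normal_density\<close>)
qed

lemma nn_integral_gauss_tilt:
  assumes "s > 0" "t > 0" and [measurable]: "H \<in> borel_measurable (block n)"
  shows "(\<integral>\<^sup>+x. H x \<partial>gauss d t n) = (\<integral>\<^sup>+x. ennreal (tilt c s d t n x) * H x \<partial>gauss c s n)"
  by (simp add: gauss_tilt[OF assms(1,2), of d n c] nn_integral_density)

lemma nn_integral_tilt:
  assumes "s > 0" "t > 0"
  shows "(\<integral>\<^sup>+x. ennreal (tilt c s d t n x) \<partial>gauss c s n) = 1"
  using nn_integral_gauss_tilt[OF assms, of "\<lambda>_. 1" n d c]
    prob_space.emeasure_space_1[OF prob_space_gauss[OF assms(2), of d n]] by simp

text \<open>Both signs of \<open>a\<close> are needed, because the key decides whether the source is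
  flipped.\<close>

lemma nn_integral_gauss_affine:
  fixes a b :: real
  assumes "s > 0" "a \<noteq> 0" and [measurable]: "H \<in> borel_measurable (block n)"
  shows "(\<integral>\<^sup>+x. H (\<lambda>i\<in>{..<n}. b + a * x i) \<partial>gauss (\<lambda>_. m) s n)
    = (\<integral>\<^sup>+x. H x \<partial>gauss (\<lambda>_. b + a * m) (\<bar>a\<bar> * s) n)"
proof -
  let ?N = "density lborel (normal_density m s)"
  interpret N: prob_space ?N by (rule prob_space_normal_density) fact
  have "distributed ?N lborel (\<lambda>x. x) (normal_density m s)"
    by (auto simp: distributed_def distr_id2)
  from N.normal_density_affine[OF this assms(1,2), of b]
  have eq: "distr ?N lborel (\<lambda>x. b + a * x) = density lborel (normal_density (b + a * m) (\<bar>a\<bar> * s))"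
    by (simp add: distributed_def)
  have "distr ?N borel (\<lambda>x. b + a * x) = density lborel (normal_density (b + a * m) (\<bar>a\<bar> * s))"
    unfolding eq[symmetric] by (intro distr_cong) auto
  note eq = this
  \<comment> \<open>The product rule for image measures wants probability spaces as targets of the
    coordinate maps, so the image measure serves as its own target.\<close>
  let ?M' = "\<lambda>_::nat. distr ?N borel (\<lambda>x. b + a * x)"
  have "distr (PiM {..<n} (\<lambda>_. ?N)) (PiM {..<n} ?M') (compose {..<n} (\<lambda>x. b + a * x))
      = PiM {..<n} (\<lambda>_. distr ?N (distr ?N borel (\<lambda>x. b + a * x)) (\<lambda>x. b + a * x))"
    by (rule distr_PiM_finite_prob_space') (auto intro!: N.prob_space_distr N.prob_space_axioms)
  also have "(\<lambda>_::nat. distr ?N (distr ?N borel (\<lambda>x. b + a * x)) (\<lambda>x. b + a * x)) = ?M'"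
    by (intro ext distr_cong) auto
  finally have D: "distr (gauss (\<lambda>_. m) s n) (block n) (compose {..<n} (\<lambda>x. b + a * x))
      = gauss (\<lambda>_. b + a * m) (\<bar>a\<bar> * s) n"
    unfolding gauss_def eq by (subst (asm) distr_cong[OF refl _ refl, of _ "block n"])
      (auto intro!: sets_PiM_cong)
  have [measurable]: "compose {..<n} (\<lambda>x. b + a * x) \<in> block n \<rightarrow>\<^sub>M block n"
    unfolding compose_def by measurable
  show ?thesis
    unfolding D[symmetric] by (subst nn_integral_distr) (auto simp: compose_def)
qed

lemma nn_integral_gauss_component:
  assumes "s > 0" "i < n" and [measurable]: "h \<in> borel_measurable borel"
  shows "(\<integral>\<^sup>+x. h (x i) \<partial>gauss c s n) = (\<integral>\<^sup>+x. h x \<partial>density lborel (normal_density (c i) s))"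
proof -
  have "density lborel (normal_density (c i) s) = distr (gauss c s n) (density lborel (normal_density (c i) s)) (\<lambda>x. x i)"
    unfolding gauss_def using assms
    by (intro distr_PiM_component[symmetric] prob_space_normal_density) auto
  then have "(\<integral>\<^sup>+x. h x \<partial>density lborel (normal_density (c i) s))
     = (\<integral>\<^sup>+x. h x \<partial>distr (gauss c s n) (density lborel (normal_density (c i) s)) (\<lambda>x. x i))" by simp
  also have "\<dots> = (\<integral>\<^sup>+x. h (x i) \<partial>gauss c s n)"
    using assms(2) by (subst nn_integral_distr) auto
  finally show ?thesis by simp
qed

lemma nn_integral_gauss_sum_squares:
  assumes "s > 0"
  shows "(\<integral>\<^sup>+x. ennreal (\<Sum>i<n. (x i - c i)\<^sup>2) \<partial>gauss c s n) = ennreal (real n * s\<^sup>2)"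
proof -
  have 1: "(\<integral>\<^sup>+x. ennreal ((x - m)\<^sup>2) \<partial>density lborel (normal_density m s)) = ennreal (s\<^sup>2)" for m
  proof -
    have "has_bochner_integral lborel (\<lambda>x. normal_density m s x * (x - m)^(2*1)) (fact (2*1) / ((2 / s\<^sup>2)^1 * fact 1))"
      by (rule normal_moment_even) fact
    moreover have "fact (2*1) / ((2 / s\<^sup>2)^1 * fact 1) = s\<^sup>2" by simp
    ultimately have "has_bochner_integral lborel (\<lambda>x. normal_density m s x * (x - m)^2) (s\<^sup>2)" by simp
    then have "(\<integral>\<^sup>+x. ennreal (normal_density m s x * (x - m)\<^sup>2) \<partial>lborel) = ennreal (s\<^sup>2)"
      by (subst nn_integral_eq_integral) (auto simp: has_bochner_integral_iff)
    then show ?thesis by (subst nn_integral_density) (auto simp: ennreal_mult')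
  qed
  have "(\<integral>\<^sup>+x. ennreal (\<Sum>i<n. (x i - c i)\<^sup>2) \<partial>gauss c s n) = (\<Sum>i<n. \<integral>\<^sup>+x. ennreal ((x i - c i)\<^sup>2) \<partial>gauss c s n)"
    by (subst nn_integral_sum[symmetric]) (auto simp: sum_ennreal)
  also have "\<dots> = (\<Sum>i<n. ennreal (s\<^sup>2))"
    using assms by (intro sum.cong refl) (subst nn_integral_gauss_component, auto simp: 1)
  finally show ?thesis by (simp add: ennreal_of_nat_eq_real_of_nat ennreal_mult')
qed

subsection \<open>Rate-distortion lower bound and concentration\<close>

text \<open>The bound is exact at every block length, with no error term. Only a pointwise lower
  bound by the distance to some codeword is asked of \<open>d\<close>, so no measurable quantiser
  has to be named; the measurable minimum \<open>D\<close> stands in for \<open>d\<close>.\<close>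

lemma gauss_distortion_lower_bound:
  fixes b :: "nat \<Rightarrow> nat \<Rightarrow> real" and d :: "(nat \<Rightarrow> real) \<Rightarrow> ennreal"
  assumes "s > 0" "finite I" "real (card I) \<le> 2 powr (real n * R)"
    and d: "\<And>x. x \<in> space (block n) \<Longrightarrow> \<exists>j\<in>I. ennreal (\<Sum>i<n. (x i - b j i)\<^sup>2) \<le> d x"
  shows "ennreal (real n * (s\<^sup>2 * 2 powr (- 2 * R))) \<le> (\<integral>\<^sup>+x. d x \<partial>gauss m s n)"
proof -
  interpret prob_space "gauss m s n" by (rule prob_space_gauss) fact
  \<comment> \<open>With this deviation the factor \<open>(s / t) ^ n\<close> in \<open>tilt\<close>
    equals \<open>N\<close>, so dividing by the number of codewords allowed leaves a pure
    exponential.\<close>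
  define t where "t = s * 2 powr (- R)"
  have "t > 0" using assms by (simp add: t_def)
  define N where "N = 2 powr (real n * R)"
  have "N > 0" by (simp add: N_def)
  have ratio: "(s / t) ^ n = N"
  proof -
    have "s / t = 2 powr R" using \<open>s > 0\<close> by (simp add: t_def powr_minus field_simps)
    then show ?thesis by (simp add: N_def powr_power mult.commute)
  qed
  have t2: "t\<^sup>2 = s\<^sup>2 * 2 powr (- 2 * R)"
    by (simp add: t_def power_mult_distrib powr_power mult.commute)
  have "I \<noteq> {}"
  proof -
    have "(\<lambda>i\<in>{..<n}. 0) \<in> space (block n)" by (simp add: space_PiM)
    from d[OF this] show ?thesis by auto
  qed
  define D where "D x = Min ((\<lambda>j. \<Sum>i<n. (x i - b j i)\<^sup>2) ` I)" for x
  have [measurable]: "D \<in> borel_measurable (block n)"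
    unfolding D_def[abs_def] using \<open>finite I\<close> by (intro borel_measurable_Min) auto
  have D_ex: "\<exists>j\<in>I. D x = (\<Sum>i<n. (x i - b j i)\<^sup>2)" for x
  proof -
    have "D x \<in> (\<lambda>j. \<Sum>i<n. (x i - b j i)\<^sup>2) ` I"
      unfolding D_def using \<open>finite I\<close> \<open>I \<noteq> {}\<close> by (intro Min_in) auto
    then show ?thesis by blast
  qed
  have D_nonneg: "0 \<le> D x" for x
    using D_ex[of x] by (auto intro!: sum_nonneg)
  have D_le: "ennreal (D x) \<le> d x" if x: "x \<in> space (block n)" for x
  proof -
    from d[OF x] obtain j where j: "j \<in> I" "ennreal (\<Sum>i<n. (x i - b j i)\<^sup>2) \<le> d x" by auto
    have "D x \<le> (\<Sum>i<n. (x i - b j i)\<^sup>2)"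
      unfolding D_def using \<open>finite I\<close> j by (intro Min_le) auto
    with j(2) show ?thesis by (meson ennreal_leI order_trans)
  qed
  let ?S = "\<lambda>x. \<Sum>i<n. (x i - m i)\<^sup>2"
  \<comment> \<open>Of the sum over codewords only the term of the nearest one is kept; the others
    are nonnegative.\<close>
  have pointwise: "1 + ?S x / (2 * s\<^sup>2) \<le> (\<Sum>j\<in>I. tilt m s (b j) t n x) / N + D x / (2 * t\<^sup>2)" for x
  proof -
    obtain j where j: "j \<in> I" "D x = (\<Sum>i<n. (x i - b j i)\<^sup>2)" using D_ex by auto
    have "1 + (?S x / (2 * s\<^sup>2) - D x / (2 * t\<^sup>2)) \<le> exp (?S x / (2 * s\<^sup>2) - D x / (2 * t\<^sup>2))"
      by (rule exp_ge_add_one_self)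
    also have "\<dots> = tilt m s (b j) t n x / N"
      using \<open>N > 0\<close> by (simp add: tilt_def ratio j(2))
    also have "\<dots> \<le> (\<Sum>j\<in>I. tilt m s (b j) t n x) / N"
      using \<open>N > 0\<close> \<open>finite I\<close> j(1) \<open>s > 0\<close> \<open>t > 0\<close>
      by (intro divide_right_mono member_le_sum) (auto simp: tilt_def)
    finally show ?thesis by simp
  qed
  have tilt_nonneg: "0 \<le> tilt m s c t n x" for c x
    using \<open>s > 0\<close> \<open>t > 0\<close> by (simp add: tilt_def)
  \<comment> \<open>The left side of the pointwise bound integrates to 1 + n/2. On the right each
    ratio integrates to one, so their sum over N contributes at most 1. The two ones cancel and
    leave n/2 below the mean of \<open>D\<close> over 2 t^2.\<close>
  have "ennreal (1 + real n / 2) = (\<integral>\<^sup>+x. (1 + ennreal (1 / (2 * s\<^sup>2)) * ennreal (?S x)) \<partial>gauss m s n)"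
    using \<open>s > 0\<close>
    by (subst nn_integral_add) (auto simp: nn_integral_cmult nn_integral_gauss_sum_squares
        emeasure_space_1[simplified] ennreal_mult[symmetric] ennreal_plus)
  also have "\<dots> \<le> (\<integral>\<^sup>+x. ennreal (1 / N) * (\<Sum>j\<in>I. ennreal (tilt m s (b j) t n x))
      + ennreal (1 / (2 * t\<^sup>2)) * ennreal (D x) \<partial>gauss m s n)"
  proof (intro nn_integral_mono)
    fix x
    have "1 + ennreal (1 / (2 * s\<^sup>2)) * ennreal (?S x) = ennreal (1 + ?S x / (2 * s\<^sup>2))"
      by (subst ennreal_plus) (auto simp: ennreal_mult[symmetric] sum_nonneg)
    also have "\<dots> \<le> ennreal ((\<Sum>j\<in>I. tilt m s (b j) t n x) / N + D x / (2 * t\<^sup>2))"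
      by (intro ennreal_leI pointwise)
    also have "\<dots> = ennreal (1 / N) * (\<Sum>j\<in>I. ennreal (tilt m s (b j) t n x))
        + ennreal (1 / (2 * t\<^sup>2)) * ennreal (D x)"
      using \<open>N > 0\<close> D_nonneg[of x]
      by (subst ennreal_plus) (auto simp: ennreal_mult[symmetric] sum_nonneg tilt_nonneg sum_ennreal)
    finally show "1 + ennreal (1 / (2 * s\<^sup>2)) * ennreal (?S x) \<le> \<dots>" .
  qed
  also have "\<dots> = ennreal (1 / N) * (\<Sum>j\<in>I. \<integral>\<^sup>+x. ennreal (tilt m s (b j) t n x) \<partial>gauss m s n)
      + ennreal (1 / (2 * t\<^sup>2)) * (\<integral>\<^sup>+x. ennreal (D x) \<partial>gauss m s n)"
    by (subst nn_integral_add) (auto simp: nn_integral_cmult nn_integral_sum)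
  also have "\<dots> = ennreal (real (card I) / N) + ennreal (1 / (2 * t\<^sup>2)) * (\<integral>\<^sup>+x. ennreal (D x) \<partial>gauss m s n)"
    using \<open>N > 0\<close> \<open>s > 0\<close> \<open>t > 0\<close>
    by (simp add: nn_integral_tilt ennreal_of_nat_eq_real_of_nat ennreal_mult[symmetric])
  also have "\<dots> \<le> 1 + ennreal (1 / (2 * t\<^sup>2)) * (\<integral>\<^sup>+x. ennreal (D x) \<partial>gauss m s n)"
    using assms(3) \<open>N > 0\<close> by (intro add_right_mono) (simp add: N_def[symmetric])
  finally have "1 + ennreal (real n / 2) \<le> 1 + ennreal (1 / (2 * t\<^sup>2)) * (\<integral>\<^sup>+x. ennreal (D x) \<partial>gauss m s n)"
    by (simp add: ennreal_plus)
  then have *: "ennreal (real n / 2) \<le> ennreal (1 / (2 * t\<^sup>2)) * (\<integral>\<^sup>+x. ennreal (D x) \<partial>gauss m s n)"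
    by (subst (asm) ennreal_add_left_cancel_le) auto
  have "ennreal (real n * t\<^sup>2) = ennreal (2 * t\<^sup>2) * ennreal (real n / 2)"
    by (simp add: ennreal_mult[symmetric])
  also have "\<dots> \<le> ennreal (2 * t\<^sup>2) * (ennreal (1 / (2 * t\<^sup>2)) * (\<integral>\<^sup>+x. ennreal (D x) \<partial>gauss m s n))"
    by (intro mult_left_mono *) simp
  also have "\<dots> = (\<integral>\<^sup>+x. ennreal (D x) \<partial>gauss m s n)"
    using \<open>t > 0\<close> by (simp add: mult.assoc[symmetric] ennreal_mult[symmetric])
  also have "\<dots> \<le> (\<integral>\<^sup>+x. d x \<partial>gauss m s n)"
    by (intro nn_integral_mono) (simp add: D_le)
  finally show ?thesis by (simp add: t2)
qed

section \<open>Concentration of the squared norm of a Gaussian vector\<close>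

definition chernoff :: "real \<Rightarrow> real" where
  "chernoff u = sqrt u * exp ((1 - u) / 2)"

lemma chernoff_nonneg: "u \<ge> 0 \<Longrightarrow> 0 \<le> chernoff u"
  by (simp add: chernoff_def)

lemma chernoff_less_1:
  assumes "u > 0" "u \<noteq> 1"
  shows "chernoff u < 1"
proof -
  have "ln u < u - 1"
    using assms ln_le_minus_one[of u] ln_eq_minus_one[of u] by fastforce
  have "chernoff u = exp (ln u / 2 + (1 - u) / 2)"
    using assms by (simp add: chernoff_def exp_add flip: ln_sqrt)
  also have "\<dots> < 1" using \<open>ln u < u - 1\<close> by (simp add: field_simps)
  finally show ?thesis .
qed

text \<open>The sign of \<open>u - 1\<close> selects the tail: the upper one for
  \<open>u > 1\<close>, the lower one for \<open>u < 1\<close>. Changing the deviation to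
  \<open>s * sqrt u\<close> makes the threshold the new mean, and on the event the density ratio is
  at least \<open>chernoff u\<close> to the power -n. For positive u, \<open>chernoff u\<close> is
  exp (-(u - 1 - ln u) / 2), the optimal Chernoff base per coordinate for a chi-square sum.\<close>

lemma gauss_tail:
  assumes "s > 0" "u > 0"
  shows "emeasure (gauss c s n)
      {x \<in> space (block n). 0 \<le> (u - 1) * ((\<Sum>i<n. (x i - c i)\<^sup>2) - real n * (u * s\<^sup>2))}
    \<le> ennreal (chernoff u ^ n)" (is "emeasure _ ?A \<le> _")
proof -
  let ?S = "\<lambda>x. \<Sum>i<n. (x i - c i)\<^sup>2"
  have t: "s * sqrt u > 0" using assms by simp
  have "chernoff u > 0" using assms by (simp add: chernoff_def)
  have "indicator ?A x \<le> ennreal (chernoff u ^ n) * ennreal (tilt c s c (s * sqrt u) n x)" for x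
  proof (cases "x \<in> ?A")
    case True
    have "?S x / (2 * s\<^sup>2) - ?S x / (2 * (s * sqrt u)\<^sup>2) = (u - 1) * ?S x / (2 * s\<^sup>2 * u)"
      using assms by (simp add: power_mult_distrib field_simps)
    also have "\<dots> \<ge> (u - 1) * (real n * (u * s\<^sup>2)) / (2 * s\<^sup>2 * u)"
      using True assms by (intro divide_right_mono) (auto simp: algebra_simps)
    also have "(u - 1) * (real n * (u * s\<^sup>2)) / (2 * s\<^sup>2 * u) = real n * ((u - 1) / 2)"
      using assms by (simp add: field_simps)
    finally have "exp ((u - 1) / 2) ^ n \<le> exp (?S x / (2 * s\<^sup>2) - ?S x / (2 * (s * sqrt u)\<^sup>2))"
      by (simp flip: exp_of_nat_mult)
    then have "((1 / sqrt u) * exp ((u - 1) / 2)) ^ n \<le> tilt c s c (s * sqrt u) n x"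
      using assms unfolding tilt_def power_mult_distrib by (intro mult_mono) auto
    then have "chernoff u ^ n * ((1 / sqrt u) * exp ((u - 1) / 2)) ^ n
        \<le> chernoff u ^ n * tilt c s c (s * sqrt u) n x"
      using \<open>chernoff u > 0\<close> by (intro mult_left_mono) auto
    moreover have "chernoff u * ((1 / sqrt u) * exp ((u - 1) / 2)) = exp ((1 - u) / 2 + (u - 1) / 2)"
      using assms unfolding exp_add by (simp add: chernoff_def)
    then have "chernoff u * ((1 / sqrt u) * exp ((u - 1) / 2)) = 1"
      using \<open>chernoff u > 0\<close> by (simp flip: add_divide_distrib)
    then have "chernoff u ^ n * ((1 / sqrt u) * exp ((u - 1) / 2)) ^ n = 1"
      by (metis power_mult_distrib power_one)
    ultimately have "1 \<le> chernoff u ^ n * tilt c s c (s * sqrt u) n x" by linarith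
    then show ?thesis
      using True \<open>chernoff u > 0\<close> by (simp add: ennreal_mult'[symmetric])
  qed simp
  then have "(\<integral>\<^sup>+x. indicator ?A x \<partial>gauss c s n)
      \<le> (\<integral>\<^sup>+x. ennreal (chernoff u ^ n) * ennreal (tilt c s c (s * sqrt u) n x) \<partial>gauss c s n)"
    by (intro nn_integral_mono)
  also have "\<dots> = ennreal (chernoff u ^ n)"
    using assms t by (simp add: nn_integral_cmult nn_integral_tilt)
  finally show ?thesis by simp
qed

definition deviation_bound :: "real \<Rightarrow> nat \<Rightarrow> real" where
  "deviation_bound \<eta> n = chernoff (1 + \<eta>) ^ n + chernoff (1 - \<eta>) ^ n"

lemma deviation_bound_nonneg: "0 < \<eta> \<Longrightarrow> \<eta> < 1 \<Longrightarrow> 0 \<le> deviation_bound \<eta> n"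
  by (simp add: deviation_bound_def chernoff_nonneg)

lemma deviation_bound_tendsto:
  assumes "0 < \<eta>" "\<eta> < 1"
  shows "deviation_bound \<eta> \<longlonglongrightarrow> 0"
proof -
  have "(\<lambda>n. chernoff (1 + \<eta>) ^ n + chernoff (1 - \<eta>) ^ n) \<longlonglongrightarrow> 0 + 0"
    using assms by (intro tendsto_add LIMSEQ_realpow_zero chernoff_nonneg chernoff_less_1) auto
  then show ?thesis by (simp add: deviation_bound_def[abs_def])
qed

lemma gauss_deviation:
  assumes "s > 0" "0 < \<eta>" "\<eta> < 1"
  shows "emeasure (gauss c s n)
      {x \<in> space (block n). real n * (s\<^sup>2 * \<eta>) \<le> \<bar>(\<Sum>i<n. (x i - c i)\<^sup>2) - real n * s\<^sup>2\<bar>}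
    \<le> ennreal (deviation_bound \<eta> n)"
proof -
  let ?A = "\<lambda>u. {x \<in> space (block n).
    0 \<le> (u - 1) * ((\<Sum>i<n. (x i - c i)\<^sup>2) - real n * (u * s\<^sup>2))}"
  have "{x \<in> space (block n). real n * (s\<^sup>2 * \<eta>) \<le> \<bar>(\<Sum>i<n. (x i - c i)\<^sup>2) - real n * s\<^sup>2\<bar>}
      \<subseteq> ?A (1 + \<eta>) \<union> ?A (1 - \<eta>)"
  proof (intro subsetI)
    fix x assume x: "x \<in> {x \<in> space (block n). real n * (s\<^sup>2 * \<eta>) \<le> \<bar>(\<Sum>i<n. (x i - c i)\<^sup>2) - real n * s\<^sup>2\<bar>}"
    let ?y = "(\<Sum>i<n. (x i - c i)\<^sup>2) - real n * s\<^sup>2"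
    from x have "real n * (s\<^sup>2 * \<eta>) \<le> ?y \<or> ?y \<le> - (real n * (s\<^sup>2 * \<eta>))" by auto
    then show "x \<in> ?A (1 + \<eta>) \<union> ?A (1 - \<eta>)"
    proof
      assume "real n * (s\<^sup>2 * \<eta>) \<le> ?y"
      then have "0 \<le> \<eta> * (?y - real n * (s\<^sup>2 * \<eta>))" using assms by simp
      with x show ?thesis by (simp add: algebra_simps)
    next
      assume "?y \<le> - (real n * (s\<^sup>2 * \<eta>))"
      then have "0 \<le> - \<eta> * (?y + real n * (s\<^sup>2 * \<eta>))" using assms by (simp add: mult_nonneg_nonpos)
      with x show ?thesis by (simp add: algebra_simps)
    qed
  qed
  then have "emeasure (gauss c s n)
      {x \<in> space (block n). real n * (s\<^sup>2 * \<eta>) \<le> \<bar>(\<Sum>i<n. (x i - c i)\<^sup>2) - real n * s\<^sup>2\<bar>}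
    \<le> emeasure (gauss c s n) (?A (1 + \<eta>) \<union> ?A (1 - \<eta>))"
    by (intro emeasure_mono) auto
  also have "\<dots> \<le> emeasure (gauss c s n) (?A (1 + \<eta>)) + emeasure (gauss c s n) (?A (1 - \<eta>))"
    by (intro emeasure_subadditive) auto
  also have "\<dots> \<le> ennreal (chernoff (1 + \<eta>) ^ n) + ennreal (chernoff (1 - \<eta>) ^ n)"
    using assms by (intro add_mono gauss_tail) auto
  also have "\<dots> = ennreal (deviation_bound \<eta> n)"
    using assms by (simp add: deviation_bound_def chernoff_nonneg ennreal_plus)
  finally show ?thesis .
qed

subsection \<open>Covering lemma\<close>

text \<open>A function above its mean everywhere would have a strictly larger mean. An infinite mean
  is no exception, since no value exceeds infinity.\<close>

lemma exists_le_nn_integral: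
  assumes "prob_space Q" and [measurable]: "F \<in> borel_measurable Q"
  shows "\<exists>c\<in>space Q. F c \<le> (\<integral>\<^sup>+c. F c \<partial>Q)"
proof (rule ccontr)
  interpret prob_space Q by fact
  assume "\<not> ?thesis"
  then have less: "(\<integral>\<^sup>+c. F c \<partial>Q) < F c" if "c \<in> space Q" for c using that by auto
  define a where "a = (\<integral>\<^sup>+c. F c \<partial>Q)"
  obtain c0 where "c0 \<in> space Q" using not_empty by auto
  have "a \<noteq> \<infinity>" using less[OF \<open>c0 \<in> space Q\<close>] by (auto simp: a_def)
  have "(\<integral>\<^sup>+c. a \<partial>Q) < (\<integral>\<^sup>+c. F c \<partial>Q)"
  proof (rule nn_integral_less)
    show "(\<integral>\<^sup>+c. a \<partial>Q) \<noteq> \<infinity>" using \<open>a \<noteq> \<infinity>\<close> by (simp add: emeasure_space_1)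
    show "AE c in Q. a \<le> F c" using less by (intro AE_I2) (auto simp: a_def less_imp_le)
    show "\<not> (AE c in Q. F c \<le> a)"
    proof
      assume "AE c in Q. F c \<le> a"
      then have "AE c in Q. False"
        using AE_space by eventually_elim (use less in \<open>force simp: a_def\<close>)
      then show False by simp
    qed
  qed auto
  then show False by (simp add: emeasure_space_1 a_def)
qed

text \<open>The method of conditional expectations, one codeword at a time, in place of a random codebook.\<close>

lemma exists_codebook_nn_integral:
  fixes U :: "'a \<Rightarrow> 'c \<Rightarrow> ennreal"
  assumes P: "prob_space P" and Q: "prob_space Q"
    and U [measurable]: "case_prod U \<in> borel_measurable (P \<Otimes>\<^sub>M Q)"
    and "u \<in> borel_measurable P"
  shows "\<exists>c. (\<forall>j::nat. c j \<in> space Q) \<and>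
    (\<integral>\<^sup>+x. u x * (\<Prod>j<N. U x (c j)) \<partial>P) \<le> (\<integral>\<^sup>+x. u x * (\<integral>\<^sup>+c. U x c \<partial>Q) ^ N \<partial>P)"
  using assms(4)
proof (induction N arbitrary: u)
  case 0
  interpret Q: prob_space Q by fact
  obtain c0 where "c0 \<in> space Q" using Q.not_empty by auto
  then show ?case by (intro exI[of _ "\<lambda>_. c0"]) simp
next
  case (Suc N)
  note [measurable] = Suc.prems
  interpret P: prob_space P by fact
  interpret Q: prob_space Q by fact
  interpret PQ: pair_sigma_finite P Q ..
  let ?a = "\<lambda>x. \<integral>\<^sup>+c. U x c \<partial>Q"
  \<comment> \<open>One codeword is fixed while the remaining \<open>N\<close> are still averaged
    out. The general weight \<open>u\<close> in the induction is what absorbs the factor of the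
    codeword just fixed.\<close>
  let ?F = "\<lambda>c. \<integral>\<^sup>+x. u x * ?a x ^ N * U x c \<partial>P"
  have "?F \<in> borel_measurable Q" by measurable
  from exists_le_nn_integral[OF Q this] obtain c0
    where c0: "c0 \<in> space Q" "?F c0 \<le> (\<integral>\<^sup>+c. ?F c \<partial>Q)" by auto
  note [measurable] = measurable_Pair1[OF U c0(1), simplified]
  have "(\<integral>\<^sup>+c. ?F c \<partial>Q) = (\<integral>\<^sup>+x. (\<integral>\<^sup>+c. u x * ?a x ^ N * U x c \<partial>Q) \<partial>P)"
    by (intro PQ.Fubini') measurable
  also have "\<dots> = (\<integral>\<^sup>+x. u x * ?a x ^ Suc N \<partial>P)"
    by (intro nn_integral_cong, subst nn_integral_cmult) (auto simp: mult_ac)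
  finally have F: "?F c0 \<le> \<dots>" using c0 by simp
  have "(\<lambda>x. u x * U x c0) \<in> borel_measurable P" by measurable
  from Suc.IH[OF this] obtain c where c: "\<forall>j. c j \<in> space Q"
    "(\<integral>\<^sup>+x. u x * U x c0 * (\<Prod>j<N. U x (c j)) \<partial>P) \<le> (\<integral>\<^sup>+x. u x * U x c0 * ?a x ^ N \<partial>P)"
    by auto
  show ?case
  proof (intro exI[of _ "c(N := c0)"] conjI allI)
    have "(\<Prod>j<Suc N. U x ((c(N := c0)) j)) = U x c0 * (\<Prod>j<N. U x (c j))" for x
    proof -
      have "(\<Prod>j<N. U x ((c(N := c0)) j)) = (\<Prod>j<N. U x (c j))" by (intro prod.cong) auto
      then show ?thesis by (simp add: mult.commute)
    qed
    then show "(\<integral>\<^sup>+x. u x * (\<Prod>j<Suc N. U x ((c(N := c0)) j)) \<partial>P) \<le> (\<integral>\<^sup>+x. u x * ?a x ^ Suc N \<partial>P)"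
      using c(2) F by (simp add: mult_ac)
  qed (use c c0 in auto)
qed

text \<open>In its use, \<open>a\<close> is the chance that a random codeword misses,
  \<open>b\<close> the chance that one drawn from the ideal channel misses. First a is at most exp
  (-(1 - b) / L); then convexity of exp on the segment from 0 to -N/L moves the power N out as the
  additive terms.\<close>

lemma power_le_add_exp:
  fixes a b L :: real
  assumes "0 \<le> a" "0 \<le> b" "b \<le> 1" "L > 0" and ab: "1 - b \<le> L * (1 - a)"
  shows "a ^ N \<le> b + exp (- real N / L)"
proof -
  have "a \<le> exp (a - 1)" using exp_ge_add_one_self[of "a - 1"] by simp
  also have "\<dots> \<le> exp (- (1 - b) / L)" using ab \<open>L > 0\<close> by (simp add: field_simps)
  finally have "a ^ N \<le> exp (- (1 - b) / L) ^ N" using assms by (intro power_mono)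
  also have "\<dots> = exp ((1 - (1 - b)) *\<^sub>R 0 + (1 - b) *\<^sub>R (- real N / L))"
    using \<open>L > 0\<close> by (simp add: field_simps flip: exp_of_nat_mult)
  also have "\<dots> \<le> (1 - (1 - b)) * exp 0 + (1 - b) * exp (- real N / L)"
    by (rule convex_onD[OF exp_convex]) (use assms in auto)
  also have "\<dots> \<le> b + 1 * exp (- real N / L)"
    using assms by (intro add_mono mult_right_mono) auto
  finally show ?thesis by simp
qed

text \<open>\<open>W x\<close> is the density, relative to the codeword law Q, of the ideal channel
  from x to a codeword. Where \<open>T\<close> holds it is at most \<open>L\<close>, so a draw from
  Q succeeds with at least 1/L times the success probability of that channel, and about L draws
  suffice to cover.\<close>

lemma covering:
  fixes T :: "'a \<Rightarrow> 'c \<Rightarrow> bool" and W :: "'a \<Rightarrow> 'c \<Rightarrow> ennreal"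
  assumes P: "prob_space P" and Q: "prob_space Q"
    and T [measurable]: "Measurable.pred (P \<Otimes>\<^sub>M Q) (case_prod T)"
    and W [measurable]: "case_prod W \<in> borel_measurable (P \<Otimes>\<^sub>M Q)"
    and W1: "\<And>x. x \<in> space P \<Longrightarrow> (\<integral>\<^sup>+c. W x c \<partial>Q) = 1"
    and WL: "\<And>x c. x \<in> space P \<Longrightarrow> c \<in> space Q \<Longrightarrow> T x c \<Longrightarrow> W x c \<le> ennreal L"
    and "L > 0"
  shows "\<exists>c. (\<forall>j::nat. c j \<in> space Q) \<and>
    emeasure P {x \<in> space P. \<forall>j<N. \<not> T x (c j)}
      \<le> (\<integral>\<^sup>+x. \<integral>\<^sup>+c. W x c * of_bool (\<not> T x c) \<partial>Q \<partial>P) + ennreal (exp (- real N / L))"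
proof -
  interpret P: prob_space P by fact
  interpret Q: prob_space Q by fact
  let ?U = "\<lambda>x c. of_bool (\<not> T x c) :: ennreal"
  have "case_prod ?U \<in> borel_measurable (P \<Otimes>\<^sub>M Q)" by measurable
  from exists_codebook_nn_integral[OF P Q this, of "\<lambda>_. 1" N] obtain c where
    c: "\<forall>j. c j \<in> space Q"
      "(\<integral>\<^sup>+x. (\<Prod>j<N. ?U x (c j)) \<partial>P) \<le> (\<integral>\<^sup>+x. (\<integral>\<^sup>+c. ?U x c \<partial>Q) ^ N \<partial>P)" by auto
  have [measurable]: "Measurable.pred P (\<lambda>x. T x (c j))" for j
    using measurable_Pair1[OF T, of "c j"] c by simp
  have "emeasure P {x \<in> space P. \<forall>j<N. \<not> T x (c j)} = (\<integral>\<^sup>+x. (\<Prod>j<N. ?U x (c j)) \<partial>P)"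
  proof -
    have "indicator {x \<in> space P. \<forall>j<N. \<not> T x (c j)} x = (\<Prod>j<N. ?U x (c j))" if "x \<in> space P" for x
      using that by (auto simp: indicator_def prod_zero_iff)
    then have "(\<integral>\<^sup>+x. (\<Prod>j<N. ?U x (c j)) \<partial>P) = (\<integral>\<^sup>+x. indicator {x \<in> space P. \<forall>j<N. \<not> T x (c j)} x \<partial>P)"
      by (intro nn_integral_cong) simp
    also have "\<dots> = emeasure P {x \<in> space P. \<forall>j<N. \<not> T x (c j)}"
      by (intro nn_integral_indicator) measurable
    finally show ?thesis ..
  qed
  also have "\<dots> \<le> (\<integral>\<^sup>+x. (\<integral>\<^sup>+c. ?U x c \<partial>Q) ^ N \<partial>P)" by (rule c)
  also have "\<dots> \<le> (\<integral>\<^sup>+x. (\<integral>\<^sup>+c. W x c * ?U x c \<partial>Q) + ennreal (exp (- real N / L)) \<partial>P)"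
  proof (intro nn_integral_mono)
    fix x assume x [measurable]: "x \<in> space P"
    have [measurable]: "Measurable.pred Q (T x)" "W x \<in> borel_measurable Q"
      using measurable_Pair2[OF T x] measurable_Pair2[OF W x] by simp_all
    let ?a = "\<integral>\<^sup>+c. ?U x c \<partial>Q" and ?p = "\<integral>\<^sup>+c. of_bool (T x c) \<partial>Q"
    let ?b = "\<integral>\<^sup>+c. W x c * ?U x c \<partial>Q" and ?q = "\<integral>\<^sup>+c. W x c * of_bool (T x c) \<partial>Q"
    have ap: "?a + ?p = 1"
    proof -
      have "?a + ?p = (\<integral>\<^sup>+c. ?U x c + of_bool (T x c) \<partial>Q)" by (subst nn_integral_add) auto
      also have "\<dots> = (\<integral>\<^sup>+c. 1 \<partial>Q)" by (intro nn_integral_cong) auto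
      finally show ?thesis by (simp add: Q.emeasure_space_1)
    qed
    have bq: "?b + ?q = 1"
    proof -
      have "?b + ?q = (\<integral>\<^sup>+c. W x c * ?U x c + W x c * of_bool (T x c) \<partial>Q)" by (subst nn_integral_add) auto
      also have "\<dots> = (\<integral>\<^sup>+c. W x c \<partial>Q)" by (intro nn_integral_cong) auto
      finally show ?thesis by (simp add: W1 x)
    qed
    have qp: "?q \<le> ennreal L * ?p"
      by (subst nn_integral_cmult[symmetric]) (auto intro!: nn_integral_mono WL x)
    \<comment> \<open>The four masses are finite, so the relations turn into real ones: a + p = 1, b
      + q = 1 and q \<le> L p give 1 - b \<le> L (1 - a).\<close>
    obtain a p where a: "?a = ennreal a" "?p = ennreal p" "a \<ge> 0" "p \<ge> 0"
      using ap by (cases ?a; cases ?p) (auto simp: top_add)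
    obtain b q where b: "?b = ennreal b" "?q = ennreal q" "b \<ge> 0" "q \<ge> 0"
      using bq by (cases ?b; cases ?q) (auto simp: top_add)
    have 1: "a + p = 1" "b + q = 1" "q \<le> L * p"
      using ap bq qp a b \<open>L > 0\<close> by (simp_all flip: ennreal_plus ennreal_mult)
    have "a ^ N \<le> b + exp (- real N / L)"
      using 1 a b \<open>L > 0\<close> by (intro power_le_add_exp) (auto simp flip: 1(1))
    then show "?a ^ N \<le> ?b + ennreal (exp (- real N / L))"
      using a b by (simp add: ennreal_power flip: ennreal_plus)
  qed
  also have "\<dots> = (\<integral>\<^sup>+x. \<integral>\<^sup>+c. W x c * ?U x c \<partial>Q \<partial>P) + ennreal (exp (- real N / L))"
    by (subst nn_integral_add) (auto simp: P.emeasure_space_1)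
  finally show ?thesis using c by auto
qed

subsection \<open>Gaussian codebooks\<close>

text \<open>Both sides are the joint density over the product of the marginals for the optimal
  Gaussian pair: x is c plus noise of variance D with c of variance 1 - D, and conversely c is (1 -
  D) x plus noise of variance D (1 - D). The left form describes x given c, the right form c given
  x.\<close>

lemma tilt_backward_channel:
  assumes "0 < D" "D < 1"
  shows "tilt (\<lambda>_. 0) 1 c (sqrt D) n x
    = tilt (\<lambda>_. 0) (sqrt (1 - D)) (\<lambda>i. (1 - D) * x i) (sqrt (D * (1 - D))) n c"
proof -
  have "(1 / sqrt D) ^ n = (sqrt (1 - D) / sqrt (D * (1 - D))) ^ n"
    using assms by (simp add: real_sqrt_mult)
  moreover have "(x i)\<^sup>2 / 2 - (x i - c i)\<^sup>2 / (2 * D)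
      = (c i)\<^sup>2 / (2 * (1 - D)) - (c i - (1 - D) * x i)\<^sup>2 / (2 * (D * (1 - D)))" for i
    using assms by (simp add: divide_simps) algebra
  then have "(\<Sum>i<n. (x i)\<^sup>2 / 2 - (x i - c i)\<^sup>2 / (2 * D))
      = (\<Sum>i<n. (c i)\<^sup>2 / (2 * (1 - D)) - (c i - (1 - D) * x i)\<^sup>2 / (2 * (D * (1 - D))))"
    by simp
  ultimately show ?thesis
    using assms by (simp add: tilt_def sum_subtractf flip: sum_divide_distrib)
qed

text \<open>Both tolerances are relative to the respective variances 1 and D, so that one
  \<open>deviation_bound\<close> at \<eta> serves both conditions. No condition on the norm of c
  itself is required.\<close>

definition typical :: "real \<Rightarrow> real \<Rightarrow> nat \<Rightarrow> (nat \<Rightarrow> real) \<Rightarrow> (nat \<Rightarrow> real) \<Rightarrow> bool" where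
  "typical D \<eta> n x c \<longleftrightarrow> \<bar>(\<Sum>i<n. (x i)\<^sup>2) - real n\<bar> < real n * \<eta>
     \<and> \<bar>(\<Sum>i<n. (x i - c i)\<^sup>2) - real n * D\<bar> < real n * (D * \<eta>)"

lemma gaussian_covering:
  fixes N n :: nat
  assumes D: "0 < D" "D < 1" and \<eta>: "0 < \<eta>" "\<eta> < 1"
  shows "\<exists>c. emeasure (gauss (\<lambda>_. 0) 1 n) {x \<in> space (block n). \<forall>j<N. \<not> typical D \<eta> n x (c j)}
    \<le> ennreal (2 * deviation_bound \<eta> n + exp (- real N / (exp \<eta> / sqrt D) ^ n))"
proof -
  let ?P = "gauss (\<lambda>_. 0) 1 n" and ?Q = "gauss (\<lambda>_. 0) (sqrt (1 - D)) n"
  let ?W = "\<lambda>x c. ennreal (tilt (\<lambda>_. 0) 1 c (sqrt D) n x)"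
  let ?A = "\<lambda>x. real n * \<eta> \<le> \<bar>(\<Sum>i<n. (x i)\<^sup>2) - real n\<bar>"
  let ?B = "\<lambda>x c. real n * (D * \<eta>) \<le> \<bar>(\<Sum>i<n. (x i - c i)\<^sup>2) - real n * D\<bar>"
  interpret P: prob_space ?P by (rule prob_space_gauss) simp
  interpret Q: prob_space ?Q by (rule prob_space_gauss) (use D in simp)
  interpret PQ: pair_sigma_finite ?P ?Q ..
  have [measurable]: "Measurable.pred (?P \<Otimes>\<^sub>M ?Q) (\<lambda>(x, c). typical D \<eta> n x c)"
    unfolding typical_def by measurable
  have [measurable]: "(\<lambda>(x, c). ?W x c) \<in> borel_measurable (?P \<Otimes>\<^sub>M ?Q)"
    unfolding tilt_def by measurable
  have [measurable]: "(\<lambda>c. ?W x c) \<in> borel_measurable (block n)" for x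
    unfolding tilt_def by measurable
  have W1: "(\<integral>\<^sup>+c. ?W x c \<partial>?Q) = 1" for x
    unfolding tilt_backward_channel[OF D] by (rule nn_integral_tilt) (use D in auto)
  \<comment> \<open>The power of 1 / sqrt D is the exponential of the mutual information of the
    Gaussian pair; exp \<eta> per letter is the slack allowed by typicality.\<close>
  define L where "L = (exp \<eta> / sqrt D) ^ n"
  have "L > 0" using D by (simp add: L_def)
  have WL: "?W x c \<le> ennreal L" if "typical D \<eta> n x c" for x c
  proof -
    have "(\<Sum>i<n. (x i)\<^sup>2) / 2 \<le> real n * (1 + \<eta>) / 2"
      using that by (intro divide_right_mono) (auto simp: typical_def algebra_simps)
    moreover have "real n * (D * (1 - \<eta>)) / (2 * D) \<le> (\<Sum>i<n. (x i - c i)\<^sup>2) / (2 * D)"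
      using that D by (intro divide_right_mono) (auto simp: typical_def algebra_simps)
    moreover have "real n * (D * (1 - \<eta>)) / (2 * D) = real n * (1 - \<eta>) / 2"
      using D by simp
    moreover have "real n * (1 + \<eta>) / 2 - real n * (1 - \<eta>) / 2 = real n * \<eta>"
      by (simp add: field_simps)
    ultimately have "(\<Sum>i<n. (x i)\<^sup>2) / 2 - (\<Sum>i<n. (x i - c i)\<^sup>2) / (2 * D) \<le> real n * \<eta>"
      by linarith
    then have "tilt (\<lambda>_. 0) 1 c (sqrt D) n x \<le> (1 / sqrt D) ^ n * exp (real n * \<eta>)"
      using D by (simp add: tilt_def divide_right_mono)
    also have "\<dots> = L" by (simp add: L_def power_divide exp_of_nat_mult)
    finally show ?thesis by (rule ennreal_leI)
  qed
  from covering[OF P.prob_space_axioms Q.prob_space_axioms, of "typical D \<eta> n" ?W L N]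
  obtain c where c: "emeasure ?P {x \<in> space ?P. \<forall>j<N. \<not> typical D \<eta> n x (c j)}
      \<le> (\<integral>\<^sup>+x. \<integral>\<^sup>+c. ?W x c * of_bool (\<not> typical D \<eta> n x c) \<partial>?Q \<partial>?P) + ennreal (exp (- real N / L))"
    using W1 WL \<open>L > 0\<close> by auto
  have A: "(\<integral>\<^sup>+x. of_bool (?A x) \<partial>?P) \<le> ennreal (deviation_bound \<eta> n)"
  proof -
    have "(\<integral>\<^sup>+x. of_bool (?A x) \<partial>?P) = (\<integral>\<^sup>+x. indicator {x \<in> space (block n). ?A x} x \<partial>?P)"
      by (intro nn_integral_cong) (simp add: indicator_def)
    also have "\<dots> = emeasure ?P {x \<in> space (block n). ?A x}"
      by (intro nn_integral_indicator) measurable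
    also have "\<dots> \<le> ennreal (deviation_bound \<eta> n)"
      using gauss_deviation[of 1 \<eta> "\<lambda>_. 0" n] \<eta> by simp
    finally show ?thesis .
  qed
  \<comment> \<open>After exchanging the integrals, for fixed c the weight turns the source into a
    Gaussian around c of variance D, and the event becomes an ordinary deviation of the
    noise.\<close>
  have "(\<integral>\<^sup>+x. \<integral>\<^sup>+c. ?W x c * of_bool (?B x c) \<partial>?Q \<partial>?P)
      = (\<integral>\<^sup>+c. \<integral>\<^sup>+x. ?W x c * of_bool (?B x c) \<partial>?P \<partial>?Q)"
    by (intro PQ.Fubini'[symmetric]) measurable
  also have "\<dots> \<le> (\<integral>\<^sup>+c. ennreal (deviation_bound \<eta> n) \<partial>?Q)"
  proof (intro nn_integral_mono)
    fix c
    have "(\<integral>\<^sup>+x. ?W x c * of_bool (?B x c) \<partial>?P) = (\<integral>\<^sup>+x. of_bool (?B x c) \<partial>gauss c (sqrt D) n)"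
      using D by (intro nn_integral_gauss_tilt[symmetric]) auto
    also have "\<dots> = (\<integral>\<^sup>+x. indicator {x \<in> space (block n). ?B x c} x \<partial>gauss c (sqrt D) n)"
      by (intro nn_integral_cong) (simp add: indicator_def)
    also have "\<dots> = emeasure (gauss c (sqrt D) n) {x \<in> space (block n). ?B x c}"
      by (intro nn_integral_indicator) measurable
    also have "\<dots> \<le> ennreal (deviation_bound \<eta> n)"
      using gauss_deviation[of "sqrt D" \<eta> c n] D \<eta> by simp
    finally show "(\<integral>\<^sup>+x. ?W x c * of_bool (?B x c) \<partial>?P) \<le> ennreal (deviation_bound \<eta> n)" .
  qed
  also have "\<dots> = ennreal (deviation_bound \<eta> n)" by (simp add: Q.emeasure_space_1[simplified])
  finally have B: "(\<integral>\<^sup>+x. \<integral>\<^sup>+c. ?W x c * of_bool (?B x c) \<partial>?Q \<partial>?P) \<le> ennreal (deviation_bound \<eta> n)" .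
  have "(\<integral>\<^sup>+x. \<integral>\<^sup>+c. ?W x c * of_bool (\<not> typical D \<eta> n x c) \<partial>?Q \<partial>?P)
      \<le> (\<integral>\<^sup>+x. \<integral>\<^sup>+c. of_bool (?A x) * ?W x c + ?W x c * of_bool (?B x c) \<partial>?Q \<partial>?P)"
    by (intro nn_integral_mono) (auto simp: typical_def not_less)
  \<comment> \<open>The first event does not involve c, and the weight integrates to one over c by
    the other reading of the same ratio.\<close>
  also have "\<dots> = (\<integral>\<^sup>+x. of_bool (?A x) \<partial>?P) + (\<integral>\<^sup>+x. \<integral>\<^sup>+c. ?W x c * of_bool (?B x c) \<partial>?Q \<partial>?P)"
    by (subst nn_integral_add[symmetric])
      (auto intro!: nn_integral_cong simp: nn_integral_add nn_integral_cmult W1)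
  also have "\<dots> \<le> ennreal (deviation_bound \<eta> n) + ennreal (deviation_bound \<eta> n)"
    by (intro add_mono A B)
  also have "\<dots> = ennreal (2 * deviation_bound \<eta> n)"
    using deviation_bound_nonneg[OF \<eta>, of n] by (simp flip: ennreal_plus)
  finally have bad: "(\<integral>\<^sup>+x. \<integral>\<^sup>+c. ?W x c * of_bool (\<not> typical D \<eta> n x c) \<partial>?Q \<partial>?P)
      \<le> ennreal (2 * deviation_bound \<eta> n)" .
  have "emeasure ?P {x \<in> space ?P. \<forall>j<N. \<not> typical D \<eta> n x (c j)}
      \<le> ennreal (2 * deviation_bound \<eta> n) + ennreal (exp (- real N / L))"
    using c add_right_mono[OF bad] by (rule order_trans)
  then show ?thesis
    using deviation_bound_nonneg[OF \<eta>, of n]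
    by (intro exI[of _ c]) (simp add: L_def flip: ennreal_plus)
qed

text \<open>Breaking ties by the least index makes the minimiser a function of finitely many
  comparisons between measurable distances, hence measurable.\<close>

lemma nearest_codeword:
  fixes c :: "nat \<Rightarrow> nat \<Rightarrow> real" and I :: "nat set"
  assumes "finite I" "I \<noteq> {}"
  shows "\<exists>f \<in> block n \<rightarrow>\<^sub>M count_space I.
    \<forall>x. \<forall>j\<in>I. (\<Sum>i<n. (x i - c (f x) i)\<^sup>2) \<le> (\<Sum>i<n. (x i - c j i)\<^sup>2)"
proof -
  let ?d = "\<lambda>x j. \<Sum>i<n. (x i - c j i)\<^sup>2"
  define f where "f x = (LEAST j. j \<in> I \<and> (\<forall>k\<in>I. ?d x j \<le> ?d x k))" for x
  have f: "f x \<in> I \<and> (\<forall>k\<in>I. ?d x (f x) \<le> ?d x k)" for x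
    unfolding f_def
  proof (rule LeastI_ex)
    have "Min (?d x ` I) \<in> ?d x ` I" using assms by (intro Min_in) auto
    then obtain j where "j \<in> I" "?d x j = Min (?d x ` I)" by auto
    then show "\<exists>j. j \<in> I \<and> (\<forall>k\<in>I. ?d x j \<le> ?d x k)" using assms by auto
  qed
  have [measurable]: "(\<lambda>x. ?d x j) \<in> borel_measurable (block n)"  for j by measurable
  have [measurable]: "Measurable.pred (block n) (\<lambda>x. ?d x j \<le> ?d x k)" for j k
    unfolding pred_def by (intro borel_measurable_le) measurable
  have "countable I" using assms by (simp add: countable_finite)
  then have [measurable]: "f \<in> block n \<rightarrow>\<^sub>M count_space UNIV"
    unfolding f_def by measurable
  have "f \<in> block n \<rightarrow>\<^sub>M count_space I"
    unfolding measurable_count_space_eq2[OF \<open>finite I\<close>] using f by auto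
  with f show ?thesis by blast
qed

lemma gaussian_code:
  fixes n M :: nat
  assumes D: "0 < D" "D < 1" and \<eta>: "0 < \<eta>" "\<eta> < 1" and "M \<ge> 1"
  shows "\<exists>c. \<exists>f \<in> block n \<rightarrow>\<^sub>M count_space {1..M}.
    (\<integral>\<^sup>+x. ennreal (\<Sum>i<n. (x i - c (f x) i)\<^sup>2) \<partial>gauss (\<lambda>_. 0) 1 n)
      \<le> ennreal (real n * (D + 2 * \<eta> + 2 * deviation_bound \<eta> n
          + exp (- real (M - 1) / (exp \<eta> / sqrt D) ^ n)))"
proof -
  let ?P = "gauss (\<lambda>_. 0) 1 n"
  interpret P: prob_space ?P by (rule prob_space_gauss) simp
  define \<delta> where "\<delta> = 2 * deviation_bound \<eta> n + exp (- real (M - 1) / (exp \<eta> / sqrt D) ^ n)"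
  have "\<delta> \<ge> 0" using deviation_bound_nonneg[OF \<eta>, of n] by (simp add: \<delta>_def)
  obtain c where c: "emeasure ?P {x \<in> space (block n). \<forall>j<M-1. \<not> typical D \<eta> n x (c j)} \<le> ennreal \<delta>"
    using gaussian_covering[OF D \<eta>, of n "M - 1"] unfolding \<delta>_def by blast
  \<comment> \<open>Index 1 is reserved for the zero word, so the distortion never exceeds the
    squared norm of x even where covering fails. This is why only \<open>M - 1\<close> covering
    words are available, shifted to the indices from 2 on.\<close>
  define c' where "c' j = (if j \<le> 1 then (\<lambda>_. 0) else c (j - 2))" for j
  have "\<exists>f \<in> block n \<rightarrow>\<^sub>M count_space {1..M}.
      \<forall>x. \<forall>j\<in>{1..M}. (\<Sum>i<n. (x i - c' (f x) i)\<^sup>2) \<le> (\<Sum>i<n. (x i - c' j i)\<^sup>2)"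
    by (rule nearest_codeword) (use \<open>M \<ge> 1\<close> in auto)
  then obtain f where f [measurable]: "f \<in> block n \<rightarrow>\<^sub>M count_space {1..M}"
    and nearest: "\<And>x j. j \<in> {1..M} \<Longrightarrow> (\<Sum>i<n. (x i - c' (f x) i)\<^sup>2) \<le> (\<Sum>i<n. (x i - c' j i)\<^sup>2)"
    by blast
  let ?d = "\<lambda>x. \<Sum>i<n. (x i - c' (f x) i)\<^sup>2"
  define F where "F = {x \<in> space (block n). \<forall>j<M-1. \<not> typical D \<eta> n x (c j)}"
  have [measurable]: "F \<in> sets (block n)"
    unfolding F_def typical_def by measurable
  have F_le: "emeasure ?P F \<le> ennreal \<delta>" using c unfolding F_def .
  have [measurable]: "?d \<in> borel_measurable (block n)"
    by (intro borel_measurable_sum borel_measurable_power borel_measurable_diff)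
      (auto intro!: measurable_compose[OF f] measurable_component_singleton)
  \<comment> \<open>Adding \<open>real n * (1 - \<eta>)\<close> avoids estimating the squared norm
    on the rare set \<open>F\<close>. Off \<open>F\<close> it lies below the squared norm, on
    \<open>F\<close> it is paid for by the indicator term; in the mean the squared norm is n, so the
    net cost is n \<eta> plus n times the probability of \<open>F\<close>.\<close>
  have pointwise: "?d x + real n * (1 - \<eta>)
      \<le> (\<Sum>i<n. (x i)\<^sup>2) + (real n * (D * (1 + \<eta>)) + real n * indicator F x)"
    if x: "x \<in> space (block n)" for x
  proof (cases "x \<in> F")
    case True
    have "?d x \<le> (\<Sum>i<n. (x i)\<^sup>2)" using nearest[of 1 x] \<open>M \<ge> 1\<close> by (simp add: c'_def)
    moreover have "real n * (1 - \<eta>) \<le> real n * (D * (1 + \<eta>)) + real n"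
      using D \<eta> by (simp add: algebra_simps mult_left_le add_nonneg_nonneg)
    ultimately show ?thesis using True by simp
  next
    case False
    with x obtain j where j: "j < M - 1" "typical D \<eta> n x (c j)" by (auto simp: F_def)
    have "?d x \<le> (\<Sum>i<n. (x i - c j i)\<^sup>2)"
      using nearest[of "j + 2" x] j by (simp add: c'_def)
    moreover have "real n * (1 - \<eta>) \<le> (\<Sum>i<n. (x i)\<^sup>2)"
      "(\<Sum>i<n. (x i - c j i)\<^sup>2) \<le> real n * (D * (1 + \<eta>))"
      using j(2) by (auto simp: typical_def abs_less_iff algebra_simps)
    ultimately show ?thesis using False by simp
  qed
  have "(\<integral>\<^sup>+x. ennreal (?d x) \<partial>?P) + ennreal (real n * (1 - \<eta>))
      = (\<integral>\<^sup>+x. ennreal (?d x + real n * (1 - \<eta>)) \<partial>?P)"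
    using \<eta> by (simp add: ennreal_plus sum_nonneg nn_integral_add P.emeasure_space_1[simplified])
  also have "\<dots> \<le> (\<integral>\<^sup>+x. ennreal (\<Sum>i<n. (x i)\<^sup>2)
      + (ennreal (real n * (D * (1 + \<eta>))) + ennreal (real n) * indicator F x) \<partial>?P)"
  proof (intro nn_integral_mono)
    fix x assume "x \<in> space ?P"
    then have "ennreal (?d x + real n * (1 - \<eta>))
        \<le> ennreal ((\<Sum>i<n. (x i)\<^sup>2) + (real n * (D * (1 + \<eta>)) + real n * indicator F x))"
      by (intro ennreal_leI pointwise) simp
    also have "\<dots> = ennreal (\<Sum>i<n. (x i)\<^sup>2)
      + (ennreal (real n * (D * (1 + \<eta>))) + ennreal (real n) * indicator F x)"
      using D \<eta> by (simp add: ennreal_plus sum_nonneg ennreal_mult ennreal_indicator)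
    finally show "ennreal (?d x + real n * (1 - \<eta>)) \<le> \<dots>" .
  qed
  also have "\<dots> = (\<integral>\<^sup>+x. ennreal (\<Sum>i<n. (x i)\<^sup>2) \<partial>?P)
      + (ennreal (real n * (D * (1 + \<eta>))) + ennreal (real n) * emeasure ?P F)"
    by (simp add: nn_integral_add nn_integral_cmult P.emeasure_space_1[simplified])
  also have "\<dots> \<le> ennreal (real n) + (ennreal (real n * (D * (1 + \<eta>))) + ennreal (real n) * ennreal \<delta>)"
    using nn_integral_gauss_sum_squares[of 1 "\<lambda>_. 0" n] F_le
    by (intro add_mono mult_left_mono) auto
  also have "\<dots> = ennreal (real n + real n * (D * (1 + \<eta>)) + real n * \<delta>)"
    using D \<eta> \<open>\<delta> \<ge> 0\<close> by (simp add: add.assoc flip: ennreal_plus ennreal_mult)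
  also have "\<dots> \<le> ennreal (real n * (D + 2 * \<eta> + \<delta>) + real n * (1 - \<eta>))"
  proof (intro ennreal_leI)
    have "real n * (D * \<eta>) \<le> real n * \<eta>" using D \<eta> by (intro mult_left_mono) auto
    then show "real n + real n * (D * (1 + \<eta>)) + real n * \<delta>
        \<le> real n * (D + 2 * \<eta> + \<delta>) + real n * (1 - \<eta>)" by (simp add: algebra_simps)
  qed
  also have "\<dots> = ennreal (real n * (D + 2 * \<eta> + \<delta>)) + ennreal (real n * (1 - \<eta>))"
    using D \<eta> \<open>\<delta> \<ge> 0\<close> by (simp add: ennreal_plus)
  finally have "(\<integral>\<^sup>+x. ennreal (?d x) \<partial>?P) + ennreal (real n * (1 - \<eta>))
      \<le> ennreal (real n * (D + 2 * \<eta> + \<delta>)) + ennreal (real n * (1 - \<eta>))" .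
  then have "ennreal (real n * (1 - \<eta>)) + (\<integral>\<^sup>+x. ennreal (?d x) \<partial>?P)
      \<le> ennreal (real n * (1 - \<eta>)) + ennreal (real n * (D + 2 * \<eta> + \<delta>))"
    unfolding add.commute[of _ "ennreal (real n * (1 - \<eta>))"] .
  then have "(\<integral>\<^sup>+x. ennreal (?d x) \<partial>?P) \<le> ennreal (real n * (D + 2 * \<eta> + \<delta>))"
    unfolding ennreal_add_left_cancel_le by simp
  then show ?thesis using f unfolding \<delta>_def add.assoc[symmetric] by blast
qed

section \<open>Rates and the asymptotic Gaussian code\<close>

lemma index_set_eq: "index_set n r = {1..nat \<lfloor>2 powr (real n * r)\<rfloor>}"
proof -
  have "real j \<le> 2 powr (real n * r) \<longleftrightarrow> j \<le> nat \<lfloor>2 powr (real n * r)\<rfloor>" for j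
  proof
    assume "j \<le> nat \<lfloor>2 powr (real n * r)\<rfloor>"
    then have "real j \<le> real (nat \<lfloor>2 powr (real n * r)\<rfloor>)" by (rule of_nat_mono)
    also have "\<dots> \<le> 2 powr (real n * r)" by (rule of_nat_floor) simp
    finally show "real j \<le> 2 powr (real n * r)" .
  qed (rule le_nat_floor)
  then show ?thesis
    unfolding index_set_def atLeastAtMost_def atLeast_def atMost_def by blast
qed

lemma index_set_nonempty: "r \<ge> 0 \<Longrightarrow> 1 \<in> index_set n r"
  by (simp add: index_set_def ge_one_powr_ge_zero)

lemma finite_index_set [simp]: "finite (index_set n r)"
  by (simp add: index_set_eq)

lemma card_index_set: "real (card (index_set n r)) \<le> 2 powr (real n * r)"
  unfolding index_set_eq card_atLeastAtMost diff_Suc_1 by (rule of_nat_floor) simp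

lemma gaussian_code_asymptotic:
  assumes "R \<ge> 0" "\<epsilon> > 0"
  shows "eventually (\<lambda>n. \<exists>c. \<exists>f \<in> block n \<rightarrow>\<^sub>M count_space (index_set n R).
    (\<integral>\<^sup>+x. ennreal (\<Sum>i<n. (x i - c (f x) i)\<^sup>2) \<partial>gauss (\<lambda>_. 0) 1 n)
      \<le> ennreal (real n * (2 powr (- 2 * R) + \<epsilon>))) sequentially"
\<comment> \<open>At rate zero the target distortion is the full variance, which the zero word
  attains; the covering code requires distortion strictly below 1.\<close>
proof (cases "R = 0")
  case True
  show ?thesis
  proof (intro always_eventually allI)
    fix n
    have "(\<integral>\<^sup>+x. ennreal (\<Sum>i<n. (x i - 0)\<^sup>2) \<partial>gauss (\<lambda>_. 0) 1 n) \<le> ennreal (real n * (2 powr (- 2 * R) + \<epsilon>))"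
      unfolding nn_integral_gauss_sum_squares[OF zero_less_one]
      using True \<open>\<epsilon> > 0\<close> by (intro ennreal_leI) (simp add: algebra_simps)
    then show "\<exists>c. \<exists>f \<in> block n \<rightarrow>\<^sub>M count_space (index_set n R).
      (\<integral>\<^sup>+x. ennreal (\<Sum>i<n. (x i - c (f x) i)\<^sup>2) \<partial>gauss (\<lambda>_. 0) 1 n)
        \<le> ennreal (real n * (2 powr (- 2 * R) + \<epsilon>))"
      using index_set_nonempty[OF \<open>R \<ge> 0\<close>]
      by (intro exI[of _ "\<lambda>_ _. 0"] bexI[of _ "\<lambda>_. 1"]) auto
  qed
next
  case False
  then have "R > 0" using assms by simp
  define D0 where "D0 = 2 powr (- 2 * R)"
  have D0: "0 < D0" "D0 < 1" using \<open>R > 0\<close> by (auto simp: D0_def powr_less_one)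
  \<comment> \<open>A distortion strictly above the optimum leaves an exponential surplus of
    codewords over the covering number; the midpoint to 1 keeps it below 1.\<close>
  define D where "D = min ((D0 + 1) / 2) (D0 + \<epsilon> / 2)"
  have D: "D0 < D" "D \<le> D0 + \<epsilon> / 2" "D < 1" "0 < D"
    using D0 \<open>\<epsilon> > 0\<close> by (auto simp: D_def min_def)
  have "sqrt D0 = 2 powr (- R)"
  proof -
    have "D0 = (2 powr (- R))\<^sup>2" by (simp add: D0_def powr_power mult.commute)
    then show ?thesis by simp
  qed
  then have "2 powr (- R) < sqrt D" using D(1) by (metis real_sqrt_less_iff)
  then have gap: "1 < 2 powr R * sqrt D" by (simp add: powr_minus field_simps)
  \<comment> \<open>Half the logarithm of the gap keeps exp \<eta> below
    \<open>2 powr R * sqrt D\<close>, and \<epsilon> / 8 makes the final sum at most \<epsilon> / 2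
    + \<epsilon> / 4 + \<epsilon> / 4 above the optimum.\<close>
  define \<eta> where "\<eta> = min (1 / 2) (min (\<epsilon> / 8) (ln (2 powr R * sqrt D) / 2))"
  have "0 < ln (2 powr R * sqrt D)" using gap by (rule ln_gt_zero)
  then have \<eta>: "0 < \<eta>" "\<eta> < 1" "\<eta> \<le> \<epsilon> / 8" "\<eta> < ln (2 powr R * sqrt D)"
    using \<open>\<epsilon> > 0\<close> by (auto simp: \<eta>_def min_def)
  define l where "l = exp \<eta> / sqrt D"
  have "sqrt D \<le> 1" using D by simp
  have "1 \<le> exp \<eta>" using \<eta> by simp
  then have "sqrt D \<le> exp \<eta>" using \<open>sqrt D \<le> 1\<close> by linarith
  then have "1 \<le> l" using D(4) by (simp add: l_def le_divide_eq)
  have "exp \<eta> < 2 powr R * sqrt D"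
    using \<eta>(4) gap by (metis exp_less_mono exp_ln less_trans zero_less_one)
  then have "l < 2 powr R" using D by (simp add: l_def field_simps)
  define r where "r = 2 powr R / l"
  have "r > 1" using \<open>l < 2 powr R\<close> \<open>1 \<le> l\<close> by (simp add: r_def)
  let ?M = "\<lambda>n. nat \<lfloor>2 powr (real n * R)\<rfloor>"
  have M1: "1 \<le> ?M n" for n
    using index_set_nonempty[OF \<open>R \<ge> 0\<close>, of n] unfolding index_set_eq by simp
  \<comment> \<open>The 2 collects the loss from rounding the number of messages down and the zero
    word. As l is at least 1, it is still at most 2 after division by \<open>l ^ n\<close>.\<close>
  have bound: "exp (- real (?M n - 1) / l ^ n) \<le> exp (2 - r ^ n)" for n
  proof -
    have "2 powr (real n * R) - 2 \<le> real (?M n - 1)"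
      using M1[of n] by linarith
    moreover have "2 powr (real n * R) = r ^ n * l ^ n"
      using \<open>1 \<le> l\<close> by (simp add: r_def power_divide powr_power mult.commute)
    ultimately have "(r ^ n * l ^ n - 2) / l ^ n \<le> real (?M n - 1) / l ^ n"
      using \<open>1 \<le> l\<close> by (intro divide_right_mono) auto
    moreover have "(r ^ n * l ^ n - 2) / l ^ n = r ^ n - 2 / l ^ n"
      using \<open>1 \<le> l\<close> by (simp add: field_simps)
    moreover have "2 / l ^ n \<le> 2"
      using one_le_power[OF \<open>1 \<le> l\<close>, of n] by (simp add: field_simps)
    ultimately show ?thesis by simp
  qed
  have "filterlim (\<lambda>n. r ^ n) at_infinity sequentially"
    using \<open>r > 1\<close> by (intro filterlim_realpow_sequentially_gt1) simp
  then have "filterlim (\<lambda>n. r ^ n) at_top sequentially"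
    using \<open>r > 1\<close> by (intro filterlim_at_infinity_imp_filterlim_at_top) auto
  then have "filterlim (\<lambda>n. 2 + - (r ^ n)) at_bot sequentially"
    unfolding filterlim_tendsto_add_at_bot_iff[OF tendsto_const] filterlim_uminus_at_top .
  then have "filterlim (\<lambda>n. 2 - r ^ n) at_bot sequentially" by simp
  then have "(\<lambda>n. exp (2 - r ^ n)) \<longlonglongrightarrow> 0"
    by (rule filterlim_compose[OF exp_at_bot])
  then have "(\<lambda>n. 2 * deviation_bound \<eta> n + exp (2 - r ^ n)) \<longlonglongrightarrow> 2 * 0 + 0"
    using \<eta> by (intro tendsto_intros deviation_bound_tendsto) auto
  then have "eventually (\<lambda>n. 2 * deviation_bound \<eta> n + exp (2 - r ^ n) < \<epsilon> / 4) sequentially"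
    using \<open>\<epsilon> > 0\<close> by (intro order_tendstoD) auto
  then show ?thesis
  proof eventually_elim
    case (elim n)
    from gaussian_code[OF D(4,3) \<eta>(1,2) M1[of n], of n]
    obtain c f where f: "f \<in> block n \<rightarrow>\<^sub>M count_space (index_set n R)" and
      "(\<integral>\<^sup>+x. ennreal (\<Sum>i<n. (x i - c (f x) i)\<^sup>2) \<partial>gauss (\<lambda>_. 0) 1 n)
      \<le> ennreal (real n * (D + 2 * \<eta> + 2 * deviation_bound \<eta> n + exp (- real (?M n - 1) / l ^ n)))"
      unfolding index_set_eq l_def by blast
    note this(2)
    also have "\<dots> \<le> ennreal (real n * (D0 + \<epsilon>))"
    proof (intro ennreal_leI mult_left_mono)
      show "D + 2 * \<eta> + 2 * deviation_bound \<eta> n + exp (- real (?M n - 1) / l ^ n) \<le> D0 + \<epsilon>"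
        using elim bound[of n] D(2) \<eta>(3) by linarith
    qed simp
    finally show ?case using f unfolding D0_def by blast
  qed
qed

subsection \<open>The joint law and the expected payoff\<close>

lemma prob_space_source: "\<sigma> > 0 \<Longrightarrow> prob_space (source \<mu> \<sigma> n)"
  by (simp add: source_eq_gauss prob_space_gauss)

lemma sets_source [simp, measurable_cong]: "sets (source \<mu> \<sigma> n) = sets (block n)"
  by (simp add: source_eq_gauss)

lemma space_source [simp]: "space (source \<mu> \<sigma> n) = space (block n)"
  by (simp add: source_eq_gauss)

lemma prob_space_uniform_index: "Rs \<ge> 0 \<Longrightarrow> prob_space (uniform_count_measure (index_set n Rs))"
  using index_set_nonempty[of Rs n] by (intro prob_space_uniform_count_measure) auto

lemma nn_integral_uniform_index:
  "(\<integral>\<^sup>+k. h k \<partial>uniform_count_measure (index_set n Rs))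
    = ennreal (1 / real (card (index_set n Rs))) * (\<Sum>k\<in>index_set n Rs. h k)"
  unfolding uniform_count_measure_def
  by (subst nn_integral_point_measure_finite) (simp_all add: sum_distrib_left)

lemma measurable_eve_step:
  assumes t: "t \<in> weak_eve_decoders R n" and m: "m \<in> index_set n R" and "i < n"
  shows "(\<lambda>z. distr (t i (m, z)) (block (Suc i)) (\<lambda>w. z(i := w))) \<in> block i \<rightarrow>\<^sub>M prob_algebra (block (Suc i))"
proof (rule measurable_distr_prob_space2)
  have "t i \<in> (count_space (index_set n R) \<Otimes>\<^sub>M block i) \<rightarrow>\<^sub>M prob_algebra borel"
    using t \<open>i < n\<close> by (auto simp: weak_eve_decoders_def)
  then show "(\<lambda>z. t i (m, z)) \<in> block i \<rightarrow>\<^sub>M prob_algebra borel"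
    by (rule measurable_Pair2) (simp add: m)
  show "(\<lambda>(z, w). z(i := w)) \<in> block i \<Otimes>\<^sub>M borel \<rightarrow>\<^sub>M block (Suc i)"
    using measurable_add_dim[of i "{..<i}" "\<lambda>_. borel"] by (simp add: lessThan_Suc)
qed

lemma eve_outputs_in_prob_algebra:
  assumes t: "t \<in> weak_eve_decoders R n" and m: "m \<in> index_set n R"
  shows "i \<le> n \<Longrightarrow> eve_outputs t m i \<in> space (prob_algebra (block i))"
proof (induction i)
  case 0
  show ?case by (simp add: space_prob_algebra prob_space_return)
next
  case (Suc i)
  then have "eve_outputs t m i \<in> space (prob_algebra (block i))" by simp
  from sets_bind'[OF this measurable_eve_step[OF t m]] prob_space_bind'[OF this measurable_eve_step[OF t m]]
  show ?case using Suc.prems by (simp add: space_prob_algebra)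
qed

lemma PiM_bob_in_prob_algebra:
  assumes g: "g \<in> bob_decoders R Rs n" and m: "m \<in> index_set n R" and k: "k \<in> index_set n Rs"
  shows "PiM {..<n} (\<lambda>i. g i (m, k)) \<in> space (prob_algebra (block n))"
    and "i < n \<Longrightarrow> prob_space (g i (m, k))" and "i < n \<Longrightarrow> sets (g i (m, k)) = sets borel"
proof -
  have *: "g i (m, k) \<in> space (prob_algebra borel)" if "i < n" for i
    using g that m k unfolding bob_decoders_def
    by (intro measurable_space[of "g i"]) (auto simp: space_pair_measure)
  then show "i < n \<Longrightarrow> prob_space (g i (m, k))" "i < n \<Longrightarrow> sets (g i (m, k)) = sets borel" for i
    by (simp_all add: space_prob_algebra)
  then show "PiM {..<n} (\<lambda>i. g i (m, k)) \<in> space (prob_algebra (block n))"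
    by (auto simp: space_prob_algebra intro!: prob_space_PiM sets_PiM_cong)
qed

text \<open>The binds of the law are peeled off one after the other, so that every later computation
  is an iterated nonnegative integral. \<open>K\<close> is the kernel that remains once source, key
  and message are fixed.\<close>

lemma
  assumes "\<sigma> > 0" "Rs \<ge> 0"
    and f: "f \<in> encoders R Rs n" and g: "g \<in> bob_decoders R Rs n" and t: "t \<in> weak_eve_decoders R n"
  shows joint_law_in_prob_algebra:
      "joint_law \<mu> \<sigma> Rs n f g t \<in> space (prob_algebra (block n \<Otimes>\<^sub>M block n \<Otimes>\<^sub>M block n))"
    and nn_integral_joint_law: "H \<in> borel_measurable (block n \<Otimes>\<^sub>M block n \<Otimes>\<^sub>M block n) \<Longrightarrow>
      (\<integral>\<^sup>+w. H w \<partial>joint_law \<mu> \<sigma> Rs n f g t)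
    = (\<integral>\<^sup>+x. \<integral>\<^sup>+k. \<integral>\<^sup>+m. \<integral>\<^sup>+y. \<integral>\<^sup>+z. H (x, y, z)
        \<partial>eve_outputs t m n \<partial>PiM {..<n} (\<lambda>i. g i (m, k)) \<partial>f (x, k)
        \<partial>uniform_count_measure (index_set n Rs) \<partial>source \<mu> \<sigma> n)"
proof -
  let ?B = "block n \<Otimes>\<^sub>M block n \<Otimes>\<^sub>M block n"
  let ?IM = "index_set n R" and ?IK = "index_set n Rs"
  let ?U = "uniform_count_measure ?IK"
  define Y where "Y m k = PiM {..<n} (\<lambda>i. g i (m, k))" for m k
  define Z where "Z m = eve_outputs t m n" for m
  define K where "K x m k = Y m k \<bind> (\<lambda>y. Z m \<bind> (\<lambda>z. return ?B (x, y, z)))" for x m k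
  have Y: "Y m k \<in> space (prob_algebra (block n))" if "m \<in> ?IM" "k \<in> ?IK" for m k
    using PiM_bob_in_prob_algebra(1)[OF g that] by (simp add: Y_def)
  have Z: "Z m \<in> space (prob_algebra (block n))" if "m \<in> ?IM" for m
    using eve_outputs_in_prob_algebra[OF t that, of n] by (simp add: Z_def)
  have Zy: "(\<lambda>(x, y). Z m \<bind> (\<lambda>z. return ?B (x, y, z))) \<in> block n \<Otimes>\<^sub>M block n \<rightarrow>\<^sub>M prob_algebra ?B"
    if "m \<in> ?IM" for m
  proof -
    have [measurable]: "(\<lambda>_. Z m) \<in> block n \<Otimes>\<^sub>M block n \<rightarrow>\<^sub>M prob_algebra (block n)" using Z[OF that] by simp
    show ?thesis by measurable
  qed
  have K_meas: "(\<lambda>x. K x m k) \<in> block n \<rightarrow>\<^sub>M prob_algebra ?B" if "m \<in> ?IM" "k \<in> ?IK" for m k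
  proof -
    have [measurable]: "(\<lambda>_. Y m k) \<in> block n \<rightarrow>\<^sub>M prob_algebra (block n)" using Y[OF that] by simp
    note [measurable] = Zy[OF that(1)]
    show ?thesis unfolding K_def by measurable
  qed
  \<comment> \<open>Message and key range over finite sets, so measurability may be checked with
    both held fixed and then glued.\<close>
  have K_joint: "(\<lambda>(w, m). K (fst w) m (snd w)) \<in> (block n \<Otimes>\<^sub>M count_space ?IK) \<Otimes>\<^sub>M count_space ?IM \<rightarrow>\<^sub>M prob_algebra ?B"
  proof -
    have "(\<lambda>v. K (fst (fst v)) (snd v) (snd (fst v))) \<in> (block n \<Otimes>\<^sub>M count_space ?IK) \<Otimes>\<^sub>M count_space ?IM \<rightarrow>\<^sub>M prob_algebra ?B"
    proof (rule measurable_compose_countable'[where I = ?IM and g = snd and f = "\<lambda>m v. K (fst (fst v)) m (snd (fst v))"])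
      fix m assume m: "m \<in> ?IM"
      show "(\<lambda>v. K (fst (fst v)) m (snd (fst v))) \<in> (block n \<Otimes>\<^sub>M count_space ?IK) \<Otimes>\<^sub>M count_space ?IM \<rightarrow>\<^sub>M prob_algebra ?B"
      proof (rule measurable_compose_countable'[where I = ?IK and g = "\<lambda>v. snd (fst v)" and f = "\<lambda>k v. K (fst (fst v)) m k"])
        fix k assume "k \<in> ?IK"
        note [measurable] = K_meas[OF m this]
        show "(\<lambda>v. K (fst (fst v)) m k) \<in> (block n \<Otimes>\<^sub>M count_space ?IK) \<Otimes>\<^sub>M count_space ?IM \<rightarrow>\<^sub>M prob_algebra ?B"
          by measurable
      qed (auto simp: countable_finite)
    qed (auto simp: countable_finite)
    then show ?thesis by (simp add: case_prod_unfold)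
  qed
  have fK: "(\<lambda>w. f w \<bind> (\<lambda>m. K (fst w) m (snd w))) \<in> block n \<Otimes>\<^sub>M count_space ?IK \<rightarrow>\<^sub>M prob_algebra ?B"
    using f K_joint unfolding encoders_def by (rule measurable_bind_prob_space2)
  then have fK': "(\<lambda>(x, k). f (x, k) \<bind> (\<lambda>m. K x m k)) \<in> block n \<Otimes>\<^sub>M count_space ?IK \<rightarrow>\<^sub>M prob_algebra ?B"
    by (simp add: case_prod_unfold)
  have U: "?U \<in> space (prob_algebra (count_space ?IK))"
    using prob_space_uniform_index[OF \<open>Rs \<ge> 0\<close>, of n]
    by (simp add: space_prob_algebra sets_uniform_count_measure_count_space)
  have UK: "(\<lambda>x. ?U \<bind> (\<lambda>k. f (x, k) \<bind> (\<lambda>m. K x m k))) \<in> block n \<rightarrow>\<^sub>M prob_algebra ?B"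
    by (rule measurable_bind_prob_space2[OF _ fK']) (use U in simp)
  have joint: "joint_law \<mu> \<sigma> Rs n f g t = source \<mu> \<sigma> n \<bind> (\<lambda>x. ?U \<bind> (\<lambda>k. f (x, k) \<bind> (\<lambda>m. K x m k)))"
    by (simp add: joint_law_def K_def Y_def Z_def)
  have cong: "M \<rightarrow>\<^sub>M L = N \<rightarrow>\<^sub>M L" if "sets M = sets N" for M :: "'x measure" and N and L :: "'y measure"
    using that by (intro measurable_cong_sets) auto
  have src: "source \<mu> \<sigma> n \<in> space (prob_algebra (block n))"
    using prob_space_source[OF \<open>\<sigma> > 0\<close>] by (simp add: space_prob_algebra)
  show "joint_law \<mu> \<sigma> Rs n f g t \<in> space (prob_algebra ?B)"
    unfolding joint using sets_bind'[OF src UK] prob_space_bind'[OF src UK] by (simp add: space_prob_algebra)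
  assume H [measurable]: "H \<in> borel_measurable ?B"
  have "(\<integral>\<^sup>+w. H w \<partial>joint_law \<mu> \<sigma> Rs n f g t)
      = (\<integral>\<^sup>+x. \<integral>\<^sup>+w. H w \<partial>(?U \<bind> (\<lambda>k. f (x, k) \<bind> (\<lambda>m. K x m k))) \<partial>source \<mu> \<sigma> n)"
    unfolding joint
    by (rule nn_integral_bind[OF H]) (use measurable_prob_algebraD[OF UK] in \<open>simp add: cong[OF sets_source]\<close>)
  also have "\<dots> = (\<integral>\<^sup>+x. \<integral>\<^sup>+k. \<integral>\<^sup>+m. \<integral>\<^sup>+y. \<integral>\<^sup>+z. H (x, y, z) \<partial>Z m \<partial>Y m k \<partial>f (x, k) \<partial>?U \<partial>source \<mu> \<sigma> n)"
  proof (intro nn_integral_cong)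
    fix x assume "x \<in> space (source \<mu> \<sigma> n)"
    then have x: "x \<in> space (block n)" by simp
    have "(\<lambda>k. f (x, k) \<bind> (\<lambda>m. K x m k)) \<in> count_space ?IK \<rightarrow>\<^sub>M subprob_algebra ?B"
      using measurable_prob_algebraD[OF measurable_Pair2[OF fK' x]] by simp
    then have "(\<integral>\<^sup>+w. H w \<partial>(?U \<bind> (\<lambda>k. f (x, k) \<bind> (\<lambda>m. K x m k))))
        = (\<integral>\<^sup>+k. \<integral>\<^sup>+w. H w \<partial>(f (x, k) \<bind> (\<lambda>m. K x m k)) \<partial>?U)"
      by (intro nn_integral_bind[OF H])
        (simp add: cong[OF sets_uniform_count_measure_count_space])
    also have "\<dots> = (\<integral>\<^sup>+k. \<integral>\<^sup>+m. \<integral>\<^sup>+y. \<integral>\<^sup>+z. H (x, y, z) \<partial>Z m \<partial>Y m k \<partial>f (x, k) \<partial>?U)"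
    proof (intro nn_integral_cong)
      fix k assume "k \<in> space ?U"
      then have k: "k \<in> ?IK" by (simp add: space_uniform_count_measure)
      have "f (x, k) \<in> space (prob_algebra (count_space ?IM))"
        using f x k unfolding encoders_def by (intro measurable_space[of f]) (auto simp: space_pair_measure)
      then have fs: "sets (f (x, k)) = sets (count_space ?IM)" by (simp add: space_prob_algebra)
      have "(\<lambda>m. K x m k) \<in> count_space ?IM \<rightarrow>\<^sub>M subprob_algebra ?B"
        using measurable_space[OF measurable_prob_algebraD[OF K_meas] x] k by auto
      then have "(\<integral>\<^sup>+w. H w \<partial>(f (x, k) \<bind> (\<lambda>m. K x m k))) = (\<integral>\<^sup>+m. \<integral>\<^sup>+w. H w \<partial>K x m k \<partial>f (x, k))"
        by (intro nn_integral_bind[OF H]) (simp add: cong[OF fs])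
      also have "\<dots> = (\<integral>\<^sup>+m. \<integral>\<^sup>+y. \<integral>\<^sup>+z. H (x, y, z) \<partial>Z m \<partial>Y m k \<partial>f (x, k))"
      proof (intro nn_integral_cong)
        fix m assume "m \<in> space (f (x, k))"
        then have m: "m \<in> ?IM" using sets_eq_imp_space_eq[OF fs] by simp
        have Ys: "sets (Y m k) = sets (block n)" and Zs: "sets (Z m) = sets (block n)"
          using Y[OF m k] Z[OF m] by (auto simp: space_prob_algebra)
        have "(\<lambda>y. Z m \<bind> (\<lambda>z. return ?B (x, y, z))) \<in> block n \<rightarrow>\<^sub>M subprob_algebra ?B"
          using measurable_prob_algebraD[OF measurable_Pair2[OF Zy[OF m] x]] by simp
        then have "(\<integral>\<^sup>+w. H w \<partial>K x m k) = (\<integral>\<^sup>+y. \<integral>\<^sup>+w. H w \<partial>(Z m \<bind> (\<lambda>z. return ?B (x, y, z))) \<partial>Y m k)"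
          unfolding K_def by (intro nn_integral_bind[OF H]) (simp add: cong[OF Ys])
        also have "\<dots> = (\<integral>\<^sup>+y. \<integral>\<^sup>+z. H (x, y, z) \<partial>Z m \<partial>Y m k)"
        proof (intro nn_integral_cong)
          fix y assume "y \<in> space (Y m k)"
          then have y [measurable]: "y \<in> space (block n)" using sets_eq_imp_space_eq[OF Ys] by simp
          note x [measurable]
          have "(\<lambda>z. return ?B (x, y, z)) \<in> block n \<rightarrow>\<^sub>M subprob_algebra ?B" by measurable
          then have "(\<integral>\<^sup>+w. H w \<partial>(Z m \<bind> (\<lambda>z. return ?B (x, y, z)))) = (\<integral>\<^sup>+z. \<integral>\<^sup>+w. H w \<partial>return ?B (x, y, z) \<partial>Z m)"
            by (intro nn_integral_bind[OF H]) (simp add: cong[OF Zs])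
          also have "\<dots> = (\<integral>\<^sup>+z. H (x, y, z) \<partial>Z m)"
            using x y sets_eq_imp_space_eq[OF Zs]
            by (intro nn_integral_cong nn_integral_return H) (auto simp: space_pair_measure)
          finally show "(\<integral>\<^sup>+w. H w \<partial>(Z m \<bind> (\<lambda>z. return ?B (x, y, z)))) = (\<integral>\<^sup>+z. H (x, y, z) \<partial>Z m)" .
        qed
        finally show "(\<integral>\<^sup>+w. H w \<partial>K x m k) = (\<integral>\<^sup>+y. \<integral>\<^sup>+z. H (x, y, z) \<partial>Z m \<partial>Y m k)" .
      qed
      finally show "(\<integral>\<^sup>+w. H w \<partial>(f (x, k) \<bind> (\<lambda>m. K x m k))) = (\<integral>\<^sup>+m. \<integral>\<^sup>+y. \<integral>\<^sup>+z. H (x, y, z) \<partial>Z m \<partial>Y m k \<partial>f (x, k))" .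
    qed
    finally show "(\<integral>\<^sup>+w. H w \<partial>(?U \<bind> (\<lambda>k. f (x, k) \<bind> (\<lambda>m. K x m k))))
        = (\<integral>\<^sup>+k. \<integral>\<^sup>+m. \<integral>\<^sup>+y. \<integral>\<^sup>+z. H (x, y, z) \<partial>Z m \<partial>Y m k \<partial>f (x, k) \<partial>?U)" .
  qed
  finally show "(\<integral>\<^sup>+w. H w \<partial>joint_law \<mu> \<sigma> Rs n f g t)
    = (\<integral>\<^sup>+x. \<integral>\<^sup>+k. \<integral>\<^sup>+m. \<integral>\<^sup>+y. \<integral>\<^sup>+z. H (x, y, z)
        \<partial>eve_outputs t m n \<partial>PiM {..<n} (\<lambda>i. g i (m, k)) \<partial>f (x, k)
        \<partial>?U \<partial>source \<mu> \<sigma> n)"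
    by (simp add: Y_def Z_def)
qed

lemma encoder_message_law:
  assumes "f \<in> encoders R Rs n" "x \<in> space (block n)" "k \<in> index_set n Rs"
  shows "prob_space (f (x, k))" "space (f (x, k)) = index_set n R"
proof -
  have "f (x, k) \<in> space (prob_algebra (count_space (index_set n R)))"
    using assms unfolding encoders_def by (intro measurable_space[of f]) (auto simp: space_pair_measure)
  then have "prob_space (f (x, k))" "sets (f (x, k)) = sets (count_space (index_set n R))"
    by (simp_all add: space_prob_algebra)
  from this(1) sets_eq_imp_space_eq[OF this(2)]
  show "prob_space (f (x, k))" "space (f (x, k)) = index_set n R" by simp_all
qed

text \<open>Only the marginal law of each letter of Bob matters here. In
  \<open>eve_distortion\<close> the joint law has to stay, because Eve's outputs feed back into her
  later kernels. Neither quantity mentions the other party's decoders.\<close>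

definition bob_distortion :: "real \<Rightarrow> real \<Rightarrow> real \<Rightarrow> nat \<Rightarrow> ((nat \<Rightarrow> real) \<times> nat \<Rightarrow> nat measure) \<Rightarrow>
     (nat \<Rightarrow> nat \<times> nat \<Rightarrow> real measure) \<Rightarrow> ennreal" where
  "bob_distortion \<mu> \<sigma> Rs n f g = (\<integral>\<^sup>+x. \<integral>\<^sup>+k. \<integral>\<^sup>+m. (\<Sum>i<n. \<integral>\<^sup>+y. ennreal ((y - x i)\<^sup>2) \<partial>g i (m, k))
    \<partial>f (x, k) \<partial>uniform_count_measure (index_set n Rs) \<partial>source \<mu> \<sigma> n)"

definition eve_distortion :: "real \<Rightarrow> real \<Rightarrow> real \<Rightarrow> nat \<Rightarrow> ((nat \<Rightarrow> real) \<times> nat \<Rightarrow> nat measure) \<Rightarrow>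
     (nat \<Rightarrow> nat \<times> (nat \<Rightarrow> real) \<Rightarrow> real measure) \<Rightarrow> ennreal" where
  "eve_distortion \<mu> \<sigma> Rs n f t = (\<integral>\<^sup>+x. \<integral>\<^sup>+k. \<integral>\<^sup>+m. \<integral>\<^sup>+z. ennreal (\<Sum>i<n. (z i - x i)\<^sup>2) \<partial>eve_outputs t m n
    \<partial>f (x, k) \<partial>uniform_count_measure (index_set n Rs) \<partial>source \<mu> \<sigma> n)"

lemma nn_integral_joint_law_bob:
  assumes "\<sigma> > 0" "Rs \<ge> 0"
    and f: "f \<in> encoders R Rs n" and g: "g \<in> bob_decoders R Rs n" and t: "t \<in> weak_eve_decoders R n"
  shows "(\<integral>\<^sup>+(x, y, z). ennreal (\<Sum>i<n. (y i - x i)\<^sup>2) \<partial>joint_law \<mu> \<sigma> Rs n f g t) = bob_distortion \<mu> \<sigma> Rs n f g"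
proof -
  have "(\<integral>\<^sup>+y. \<integral>\<^sup>+z. ennreal (\<Sum>i<n. (y i - x i)\<^sup>2) \<partial>eve_outputs t m n \<partial>PiM {..<n} (\<lambda>i. g i (m, k)))
      = (\<Sum>i<n. \<integral>\<^sup>+y. ennreal ((y - x i)\<^sup>2) \<partial>g i (m, k))"
    if k: "k \<in> index_set n Rs" and m: "m \<in> index_set n R" for x :: "nat \<Rightarrow> real" and k m
  proof -
    have "prob_space (eve_outputs t m n)"
      using eve_outputs_in_prob_algebra[OF t m, of n] by (simp add: space_prob_algebra)
    then have "(\<integral>\<^sup>+y. \<integral>\<^sup>+z. ennreal (\<Sum>i<n. (y i - x i)\<^sup>2) \<partial>eve_outputs t m n \<partial>PiM {..<n} (\<lambda>i. g i (m, k)))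
        = (\<integral>\<^sup>+y. (\<Sum>i<n. ennreal ((y i - x i)\<^sup>2)) \<partial>PiM {..<n} (\<lambda>i. g i (m, k)))"
      by (simp add: prob_space.emeasure_space_1 sum_ennreal)
    also have "\<dots> = (\<Sum>i<n. \<integral>\<^sup>+y. ennreal ((y i - x i)\<^sup>2) \<partial>PiM {..<n} (\<lambda>i. g i (m, k)))"
    proof (rule nn_integral_sum)
      fix i assume i: "i \<in> {..<n}"
      have "sets (g i (m, k)) = sets borel"
        using PiM_bob_in_prob_algebra(3)[OF g m k] i by simp
      have [measurable]: "(\<lambda>y. y i) \<in> PiM {..<n} (\<lambda>i. g i (m, k)) \<rightarrow>\<^sub>M borel"
        unfolding measurable_cong_sets[OF refl \<open>sets (g i (m, k)) = sets borel\<close>, symmetric]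
        by (rule measurable_component_singleton[OF i])
      show "(\<lambda>y. ennreal ((y i - x i)\<^sup>2)) \<in> borel_measurable (PiM {..<n} (\<lambda>i. g i (m, k)))"
        by measurable
    qed
    also have "\<dots> = (\<Sum>i<n. \<integral>\<^sup>+y. ennreal ((y - x i)\<^sup>2) \<partial>g i (m, k))"
    proof (intro sum.cong refl)
      fix i assume i: "i \<in> {..<n}"
      have [measurable_cong]: "sets (g i (m, k)) = sets borel"
        using PiM_bob_in_prob_algebra(3)[OF g m k] i by simp
      have "(\<integral>\<^sup>+y. ennreal ((y - x i)\<^sup>2) \<partial>g i (m, k))
          = (\<integral>\<^sup>+y. ennreal ((y - x i)\<^sup>2) \<partial>distr (PiM {..<n} (\<lambda>i. g i (m, k))) (g i (m, k)) (\<lambda>y. y i))"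
        using i PiM_bob_in_prob_algebra(2)[OF g m k]
        by (subst distr_PiM_component) auto
      also have "\<dots> = (\<integral>\<^sup>+y. ennreal ((y i - x i)\<^sup>2) \<partial>PiM {..<n} (\<lambda>i. g i (m, k)))"
        using i by (intro nn_integral_distr) measurable
      finally show "(\<integral>\<^sup>+y. ennreal ((y i - x i)\<^sup>2) \<partial>PiM {..<n} (\<lambda>i. g i (m, k)))
        = (\<integral>\<^sup>+y. ennreal ((y - x i)\<^sup>2) \<partial>g i (m, k))" by simp
    qed
    finally show ?thesis .
  qed
  then show ?thesis
    unfolding bob_distortion_def
    by (subst nn_integral_joint_law[OF assms])
      (auto intro!: nn_integral_cong simp: space_uniform_count_measure encoder_message_law[OF f])
qed

lemma nn_integral_joint_law_eve:
  assumes "\<sigma> > 0" "Rs \<ge> 0"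
    and f: "f \<in> encoders R Rs n" and g: "g \<in> bob_decoders R Rs n" and t: "t \<in> weak_eve_decoders R n"
  shows "(\<integral>\<^sup>+(x, y, z). ennreal (\<Sum>i<n. (z i - x i)\<^sup>2) \<partial>joint_law \<mu> \<sigma> Rs n f g t) = eve_distortion \<mu> \<sigma> Rs n f t"
proof -
  have "prob_space (PiM {..<n} (\<lambda>i. g i (m, k)))"
    if "k \<in> index_set n Rs" "m \<in> index_set n R" for k m
    using PiM_bob_in_prob_algebra(1)[OF g that(2,1)] by (simp add: space_prob_algebra)
  then show ?thesis
    unfolding eve_distortion_def
    by (subst nn_integral_joint_law[OF assms])
      (auto intro!: nn_integral_cong simp: space_uniform_count_measure encoder_message_law[OF f] prob_space.emeasure_space_1)
qed

text \<open>With p and q the integrals of the positive and negative parts of a - b, the pointwise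
  identity gives p + B = q + A. Since p \<le> A and q \<le> B, finiteness of A or B makes one of p
  and q finite and the rearrangement legitimate.\<close>

lemma expectation_ereal_diff:
  assumes [measurable]: "a \<in> borel_measurable P" "b \<in> borel_measurable P"
    and nonneg: "\<And>w. 0 \<le> a w" "\<And>w. 0 \<le> b w"
    and fin: "(\<integral>\<^sup>+w. ennreal (a w) \<partial>P) \<noteq> \<infinity> \<or> (\<integral>\<^sup>+w. ennreal (b w) \<partial>P) \<noteq> \<infinity>"
  shows "expectation_ereal P (\<lambda>w. a w - b w)
    = enn2ereal (\<integral>\<^sup>+w. ennreal (a w) \<partial>P) - enn2ereal (\<integral>\<^sup>+w. ennreal (b w) \<partial>P)"
proof -
  let ?A = "\<integral>\<^sup>+w. ennreal (a w) \<partial>P" and ?B = "\<integral>\<^sup>+w. ennreal (b w) \<partial>P"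
  let ?p = "\<integral>\<^sup>+w. ennreal (a w - b w) \<partial>P" and ?q = "\<integral>\<^sup>+w. ennreal (b w - a w) \<partial>P"
  have "?p + ?B = (\<integral>\<^sup>+w. ennreal (a w - b w) + ennreal (b w) \<partial>P)" by (subst nn_integral_add) auto
  also have "\<dots> = (\<integral>\<^sup>+w. ennreal (b w - a w) + ennreal (a w) \<partial>P)"
  proof (intro nn_integral_cong)
    fix w
    show "ennreal (a w - b w) + ennreal (b w) = ennreal (b w - a w) + ennreal (a w)"
      using nonneg[of w] by (cases "a w \<le> b w") (auto simp: ennreal_neg simp flip: ennreal_plus)
  qed
  also have "\<dots> = ?q + ?A" by (subst nn_integral_add) auto
  finally have eq: "?p + ?B = ?q + ?A" .
  have le: "?p \<le> ?A" "?q \<le> ?B" using nonneg by (auto intro!: nn_integral_mono ennreal_leI)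
  have "enn2ereal ?p - enn2ereal ?q = enn2ereal ?A - enn2ereal ?B"
    using eq le fin
    by (cases ?A; cases ?B; cases ?p; cases ?q)
      (auto simp: enn2ereal_ennreal top_unique simp flip: ennreal_plus)
  then show ?thesis by (simp add: expectation_ereal_def)
qed

lemma expectation_block_payoff:
  assumes "\<sigma> > 0" "Rs \<ge> 0" "n > 0"
    and f: "f \<in> encoders R Rs n" and g: "g \<in> bob_decoders R Rs n" and t: "t \<in> weak_eve_decoders R n"
    and fin: "eve_distortion \<mu> \<sigma> Rs n f t \<noteq> \<infinity> \<or> bob_distortion \<mu> \<sigma> Rs n f g \<noteq> \<infinity>"
  shows "expectation_ereal (joint_law \<mu> \<sigma> Rs n f g t) (block_payoff \<sigma> n)
    = enn2ereal (ennreal (1 / (real n * \<sigma>\<^sup>2)) * eve_distortion \<mu> \<sigma> Rs n f t)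
    - enn2ereal (ennreal (1 / (real n * \<sigma>\<^sup>2)) * bob_distortion \<mu> \<sigma> Rs n f g)"
proof -
  let ?P = "joint_law \<mu> \<sigma> Rs n f g t" and ?c = "1 / (real n * \<sigma>\<^sup>2)"
  let ?a = "\<lambda>(x, y, z). ?c * (\<Sum>i<n. (z i - x i)\<^sup>2) :: real"
  let ?b = "\<lambda>(x, y, z). ?c * (\<Sum>i<n. (y i - x i)\<^sup>2) :: real"
  have [measurable_cong]: "sets ?P = sets (block n \<Otimes>\<^sub>M block n \<Otimes>\<^sub>M block n)"
    using joint_law_in_prob_algebra[OF assms(1,2) f g t] by (simp add: space_prob_algebra)
  have c: "?c > 0" using assms by simp
  have payoff: "block_payoff \<sigma> n = (\<lambda>w. ?a w - ?b w)"
    by (auto simp: block_payoff_def payoff_def sum_subtractf right_diff_distrib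
        simp flip: sum_distrib_left sum_divide_distrib)
  have a: "(\<integral>\<^sup>+w. ennreal (?a w) \<partial>?P) = ennreal ?c * eve_distortion \<mu> \<sigma> Rs n f t"
    unfolding nn_integral_joint_law_eve[OF assms(1,2) f g t, symmetric]
    using c by (subst nn_integral_cmult[symmetric]) (auto intro!: nn_integral_cong simp: ennreal_mult[symmetric] sum_nonneg)
  have b: "(\<integral>\<^sup>+w. ennreal (?b w) \<partial>?P) = ennreal ?c * bob_distortion \<mu> \<sigma> Rs n f g"
    unfolding nn_integral_joint_law_bob[OF assms(1,2) f g t, symmetric]
    using c by (subst nn_integral_cmult[symmetric]) (auto intro!: nn_integral_cong simp: ennreal_mult[symmetric] sum_nonneg)
  show ?thesis
    unfolding payoff a[symmetric] b[symmetric]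
  proof (rule expectation_ereal_diff)
    show "(\<integral>\<^sup>+w. ennreal (?a w) \<partial>?P) \<noteq> \<infinity> \<or> (\<integral>\<^sup>+w. ennreal (?b w) \<partial>?P) \<noteq> \<infinity>"
      unfolding a b using fin by (auto simp: ennreal_mult_eq_top_iff)
    show "0 \<le> ?a w" "0 \<le> ?b w" for w
      using c by (auto simp: case_prod_unfold intro!: divide_nonneg_nonneg sum_nonneg)
  qed measurable
qed

subsection \<open>Converse\<close>

text \<open>Constant only in her past outputs: the reply may vary with message and time. Such
  deterministic replies suffice for both converse bounds.\<close>

definition constant_eve :: "(nat \<Rightarrow> nat \<Rightarrow> real) \<Rightarrow> nat \<Rightarrow> nat \<times> (nat \<Rightarrow> real) \<Rightarrow> real measure" where
  "constant_eve b i = (\<lambda>(m, z). return borel (b m i))"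

lemma constant_eve_in_weak_eve_decoders: "constant_eve b \<in> weak_eve_decoders R n"
  unfolding weak_eve_decoders_def constant_eve_def
proof (intro CollectI allI impI)
  fix i
  have [measurable]: "(\<lambda>m. b m i) \<in> count_space (index_set n R) \<rightarrow>\<^sub>M borel" by simp
  show "(\<lambda>(m, z). return borel (b m i)) \<in> count_space (index_set n R) \<Otimes>\<^sub>M block i \<rightarrow>\<^sub>M prob_algebra borel"
    by measurable
qed

lemma eve_outputs_constant_eve:
  assumes "m \<in> index_set n R"
  shows "i \<le> n \<Longrightarrow> eve_outputs (constant_eve b) m i = return (block i) (\<lambda>j\<in>{..<i}. b m j)"
proof (induction i)
  case (Suc i)
  let ?v = "\<lambda>j\<in>{..<i}. b m j"
  have v: "?v \<in> space (block i)" by (auto simp: space_PiM)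
  have "eve_outputs (constant_eve b) m (Suc i)
      = return (block i) ?v \<bind> (\<lambda>z. distr (constant_eve b i (m, z)) (block (Suc i)) (\<lambda>w. z(i := w)))"
    unfolding eve_outputs.simps using Suc.prems by (subst Suc.IH) auto
  also have "\<dots> = distr (constant_eve b i (m, ?v)) (block (Suc i)) (\<lambda>w. ?v(i := w))"
    using Suc.prems
    by (intro bind_return[OF measurable_prob_algebraD[OF
          measurable_eve_step[OF constant_eve_in_weak_eve_decoders assms]] v]) simp
  also have "\<dots> = return (block (Suc i)) (?v(i := b m i))"
    unfolding constant_eve_def prod.case using measurable_component_update[OF v, of i]
    by (intro distr_return) (auto simp: lessThan_Suc)
  also have "?v(i := b m i) = (\<lambda>j\<in>{..<Suc i}. b m j)"
    by (auto simp: fun_eq_iff less_Suc_eq)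
  finally show ?case .
qed (simp add: restrict_def)

lemma eve_distortion_constant_eve:
  assumes f: "f \<in> encoders R Rs n"
  shows "eve_distortion \<mu> \<sigma> Rs n f (constant_eve b)
    = (\<integral>\<^sup>+x. \<integral>\<^sup>+k. \<integral>\<^sup>+m. ennreal (\<Sum>i<n. (b m i - x i)\<^sup>2)
    \<partial>f (x, k) \<partial>uniform_count_measure (index_set n Rs) \<partial>source \<mu> \<sigma> n)"
proof -
  have "(\<integral>\<^sup>+z. ennreal (\<Sum>i<n. (z i - x i)\<^sup>2) \<partial>eve_outputs (constant_eve b) m n)
      = ennreal (\<Sum>i<n. (b m i - x i)\<^sup>2)" if "m \<in> index_set n R" for m and x :: "nat \<Rightarrow> real"
    by (subst eve_outputs_constant_eve[OF that order_refl], subst nn_integral_return)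
      (auto simp: space_PiM)
  then show ?thesis
    unfolding eve_distortion_def
    by (intro nn_integral_cong) (simp add: space_uniform_count_measure encoder_message_law[OF f])
qed

text \<open>Common frame of both converse bounds. A finite distortion \<open>a\<close> for one reply
  of Eve keeps the difference meaningful even when Bob's distortion is infinite.\<close>

lemma secrecy_value_le:
  assumes "\<sigma> > 0" "Rs \<ge> 0" "n > 0"
    and "\<And>f g. f \<in> encoders R Rs n \<Longrightarrow> g \<in> bob_decoders R Rs n \<Longrightarrow>
      \<exists>b a. 0 \<le> a \<and> 0 \<le> a - real n * \<sigma>\<^sup>2 * v \<and> eve_distortion \<mu> \<sigma> Rs n f (constant_eve b) = ennreal a
        \<and> ennreal (a - real n * \<sigma>\<^sup>2 * v) \<le> bob_distortion \<mu> \<sigma> Rs n f g"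
  shows "secrecy_value \<mu> \<sigma> R Rs n \<le> ereal v"
  unfolding secrecy_value_def
proof (rule SUP_least, clarify)
  fix f g assume f: "f \<in> encoders R Rs n" and g: "g \<in> bob_decoders R Rs n"
  from assms(4)[OF f g] obtain b a where a: "0 \<le> a" "0 \<le> a - real n * \<sigma>\<^sup>2 * v"
    and eve: "eve_distortion \<mu> \<sigma> Rs n f (constant_eve b) = ennreal a"
    and bob: "ennreal (a - real n * \<sigma>\<^sup>2 * v) \<le> bob_distortion \<mu> \<sigma> Rs n f g" by blast
  let ?c = "1 / (real n * \<sigma>\<^sup>2)"
  have c: "?c > 0" using assms by simp
  note t = constant_eve_in_weak_eve_decoders[of b R n]
  have "(INF t\<in>weak_eve_decoders R n. expectation_ereal (joint_law \<mu> \<sigma> Rs n f g t) (block_payoff \<sigma> n))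
      \<le> expectation_ereal (joint_law \<mu> \<sigma> Rs n f g (constant_eve b)) (block_payoff \<sigma> n)"
    by (rule INF_lower) (rule t)
  also have "\<dots> = enn2ereal (ennreal ?c * ennreal a) - enn2ereal (ennreal ?c * bob_distortion \<mu> \<sigma> Rs n f g)"
    using expectation_block_payoff[OF assms(1-3) f g t] eve by simp
  also have "\<dots> \<le> enn2ereal (ennreal ?c * ennreal a) - enn2ereal (ennreal ?c * ennreal (a - real n * \<sigma>\<^sup>2 * v))"
    by (intro ereal_minus_mono order_refl) (simp add: less_eq_ennreal.rep_eq[symmetric] mult_left_mono bob)
  also have "\<dots> = ereal (?c * a - ?c * (a - real n * \<sigma>\<^sup>2 * v))"
    using a c by (simp add: enn2ereal_ennreal del: times_divide_eq_left flip: ennreal_mult)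
  also have "?c * a - ?c * (a - real n * \<sigma>\<^sup>2 * v) = v"
    using assms by (simp add: field_simps)
  finally show "(INF t\<in>weak_eve_decoders R n. expectation_ereal (joint_law \<mu> \<sigma> Rs n f g t) (block_payoff \<sigma> n)) \<le> ereal v" .
qed

section \<open>Derandomising Bob and the two converse bounds\<close>

lemma mean_minimizes_distortion:
  fixes x :: real
  assumes "prob_space G" and [measurable_cong]: "sets G = sets borel"
  shows "ennreal (((\<integral>y. y \<partial>G) - x)\<^sup>2) \<le> (\<integral>\<^sup>+y. ennreal ((y - x)\<^sup>2) \<partial>G)"
proof (cases "(\<integral>\<^sup>+y. ennreal ((y - x)\<^sup>2) \<partial>G) = \<infinity>")
  case False
  interpret prob_space G by fact
  have sq: "integrable G (\<lambda>y. (y - x)\<^sup>2)"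
    using False by (intro integrableI_nonneg) (auto simp: less_top)
  have "integrable G (\<lambda>y. y - x)"
  proof (rule Bochner_Integration.integrable_bound)
    show "integrable G (\<lambda>y. 1 + (y - x)\<^sup>2)" using sq by simp
    have "\<bar>u\<bar> \<le> 1 + u\<^sup>2" for u :: real
      using sum_power2_ge_zero[of "\<bar>u\<bar> - 1" 0] by (simp add: power2_eq_square algebra_simps)
    then show "AE y in G. norm (y - x) \<le> norm (1 + (y - x)\<^sup>2)" by simp
  qed measurable
  then have "integrable G (\<lambda>y. (y - x) + x)" by (rule Bochner_Integration.integrable_add) simp
  then have y: "integrable G (\<lambda>y. y)" by simp
  define b where "b = (\<integral>y. y \<partial>G)"
  \<comment> \<open>Jensen's inequality by the tangent of the square at \<open>b - x\<close>: the
    tangent integrates to its value at the mean.\<close>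
  have "(b - x)\<^sup>2 = (\<integral>y. 2 * (b - x) * (y - x) - (b - x)\<^sup>2 \<partial>G)"
    using y by (simp add: prob_space b_def[symmetric] power2_eq_square algebra_simps)
  also have "\<dots> \<le> (\<integral>y. (y - x)\<^sup>2 \<partial>G)"
  proof (rule integral_mono)
    show "integrable G (\<lambda>y. 2 * (b - x) * (y - x) - (b - x)\<^sup>2)" using y by simp
    show "2 * (b - x) * (y - x) - (b - x)\<^sup>2 \<le> (y - x)\<^sup>2" for y
      using zero_le_power2[of "(y - x) - (b - x)"] by (simp add: power2_eq_square algebra_simps)
  qed (rule sq)
  finally have "ennreal ((b - x)\<^sup>2) \<le> ennreal (\<integral>y. (y - x)\<^sup>2 \<partial>G)" by (rule ennreal_leI)
  also have "\<dots> = (\<integral>\<^sup>+y. ennreal ((y - x)\<^sup>2) \<partial>G)"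
    using sq by (intro nn_integral_eq_integral[symmetric]) auto
  finally show ?thesis by (simp add: b_def)
qed simp

text \<open>If the law has no mean, the integral defaults to 0. This is harmless: the corresponding
  squared distortion is then infinite, so comparisons with it hold trivially.\<close>

definition bob_mean :: "(nat \<Rightarrow> nat \<times> nat \<Rightarrow> real measure) \<Rightarrow> nat \<Rightarrow> nat \<Rightarrow> nat \<Rightarrow> real" where
  "bob_mean g k m i = (\<integral>y. y \<partial>g i (m, k))"

lemma bob_mean_minimizes:
  assumes g: "g \<in> bob_decoders R Rs n" and m: "m \<in> index_set n R" and k: "k \<in> index_set n Rs"
  shows "ennreal (\<Sum>i<n. (bob_mean g k m i - x i)\<^sup>2) \<le> (\<Sum>i<n. \<integral>\<^sup>+y. ennreal ((y - x i)\<^sup>2) \<partial>g i (m, k))"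
proof -
  have "ennreal (\<Sum>i<n. (bob_mean g k m i - x i)\<^sup>2) = (\<Sum>i<n. ennreal ((bob_mean g k m i - x i)\<^sup>2))"
    by (simp add: sum_ennreal)
  also have "\<dots> \<le> (\<Sum>i<n. \<integral>\<^sup>+y. ennreal ((y - x i)\<^sup>2) \<partial>g i (m, k))"
    unfolding bob_mean_def using PiM_bob_in_prob_algebra(2,3)[OF g m k]
    by (intro sum_mono mean_minimizes_distortion) auto
  finally show ?thesis .
qed

text \<open>For each fixed key the vectors of means, one per message, form a codebook of admissible
  size. The bound holds key by key, so sharing a key cannot lower the distortion on average.\<close>

lemma bob_distortion_lower_bound:
  assumes "\<sigma> > 0" "Rs \<ge> 0" "R \<ge> 0"
    and f: "f \<in> encoders R Rs n" and g: "g \<in> bob_decoders R Rs n"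
  shows "ennreal (real n * (\<sigma>\<^sup>2 * 2 powr (- 2 * R))) \<le> bob_distortion \<mu> \<sigma> Rs n f g"
proof -
  let ?IM = "index_set n R" and ?IK = "index_set n Rs" and ?\<beta> = "ennreal (real n * (\<sigma>\<^sup>2 * 2 powr (- 2 * R)))"
  have "?IM \<noteq> {}" "?IK \<noteq> {}" using index_set_nonempty assms by blast+
  then have card: "card ?IK > 0" by (simp add: card_gt_0_iff)
  define D where "D k x = Min ((\<lambda>m. \<Sum>i<n. (x i - bob_mean g k m i)\<^sup>2) ` ?IM)" for k x
  have [measurable]: "D k \<in> borel_measurable (block n)" for k
    unfolding D_def[abs_def] by (intro borel_measurable_Min) auto
  have D_bound: "?\<beta> \<le> (\<integral>\<^sup>+x. ennreal (D k x) \<partial>source \<mu> \<sigma> n)" for k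
    unfolding source_eq_gauss
  proof (rule gauss_distortion_lower_bound[OF \<open>\<sigma> > 0\<close> finite_index_set card_index_set])
    fix x
    have "D k x \<in> (\<lambda>m. \<Sum>i<n. (x i - bob_mean g k m i)\<^sup>2) ` ?IM"
      unfolding D_def using \<open>?IM \<noteq> {}\<close> by (intro Min_in) auto
    then show "\<exists>m\<in>?IM. ennreal (\<Sum>i<n. (x i - bob_mean g k m i)\<^sup>2) \<le> ennreal (D k x)" by auto
  qed
  have "?\<beta> = ennreal (1 / real (card ?IK)) * (\<Sum>k\<in>?IK. ?\<beta>)"
    using card \<open>?IK \<noteq> {}\<close> by (simp add: ennreal_of_nat_eq_real_of_nat mult.assoc[symmetric] flip: ennreal_mult)
  also have "\<dots> \<le> ennreal (1 / real (card ?IK)) * (\<Sum>k\<in>?IK. \<integral>\<^sup>+x. ennreal (D k x) \<partial>source \<mu> \<sigma> n)"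
    by (intro mult_left_mono sum_mono D_bound) simp
  also have "\<dots> = (\<integral>\<^sup>+x. ennreal (1 / real (card ?IK)) * (\<Sum>k\<in>?IK. ennreal (D k x)) \<partial>source \<mu> \<sigma> n)"
    by (simp add: nn_integral_sum nn_integral_cmult)
  also have "\<dots> = (\<integral>\<^sup>+x. \<integral>\<^sup>+k. ennreal (D k x) \<partial>uniform_count_measure ?IK \<partial>source \<mu> \<sigma> n)"
    by (simp add: nn_integral_uniform_index)
  also have "\<dots> \<le> bob_distortion \<mu> \<sigma> Rs n f g"
    unfolding bob_distortion_def
  proof (intro nn_integral_mono)
    fix x k assume "x \<in> space (source \<mu> \<sigma> n)" "k \<in> space (uniform_count_measure ?IK)"
    then have x: "x \<in> space (block n)" and k: "k \<in> ?IK" by (auto simp: space_uniform_count_measure)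
    interpret prob_space "f (x, k)" by (rule encoder_message_law[OF f x k])
    have "ennreal (D k x) = (\<integral>\<^sup>+m. ennreal (D k x) \<partial>f (x, k))" by (simp add: emeasure_space_1)
    also have "\<dots> \<le> (\<integral>\<^sup>+m. (\<Sum>i<n. \<integral>\<^sup>+y. ennreal ((y - x i)\<^sup>2) \<partial>g i (m, k)) \<partial>f (x, k))"
    proof (intro nn_integral_mono)
      fix m assume "m \<in> space (f (x, k))"
      then have m: "m \<in> ?IM" using encoder_message_law[OF f x k] by simp
      have "D k x \<le> (\<Sum>i<n. (x i - bob_mean g k m i)\<^sup>2)"
        unfolding D_def using m by (intro Min_le) auto
      then have "ennreal (D k x) \<le> ennreal (\<Sum>i<n. (bob_mean g k m i - x i)\<^sup>2)"
        by (intro ennreal_leI) (simp add: power2_commute)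
      also note bob_mean_minimizes[OF g m k]
      finally show "ennreal (D k x) \<le> (\<Sum>i<n. \<integral>\<^sup>+y. ennreal ((y - x i)\<^sup>2) \<partial>g i (m, k))" .
    qed
    finally show "ennreal (D k x) \<le> (\<integral>\<^sup>+m. (\<Sum>i<n. \<integral>\<^sup>+y. ennreal ((y - x i)\<^sup>2) \<partial>g i (m, k)) \<partial>f (x, k))" .
  qed
  finally show ?thesis .
qed

lemma converse_rate:
  assumes "\<sigma> > 0" "Rs \<ge> 0" "R \<ge> 0" "n > 0"
  shows "secrecy_value \<mu> \<sigma> R Rs n \<le> ereal (1 - 2 powr (- 2 * R))"
proof (rule secrecy_value_le[OF assms(1,2,4)])
  fix f g assume f: "f \<in> encoders R Rs n" and g: "g \<in> bob_decoders R Rs n"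
  interpret U: prob_space "uniform_count_measure (index_set n Rs)"
    by (rule prob_space_uniform_index) fact
  have "eve_distortion \<mu> \<sigma> Rs n f (constant_eve (\<lambda>_ _. \<mu>))
      = (\<integral>\<^sup>+x. \<integral>\<^sup>+k. ennreal (\<Sum>i<n. (\<mu> - x i)\<^sup>2) \<partial>uniform_count_measure (index_set n Rs) \<partial>source \<mu> \<sigma> n)"
    unfolding eve_distortion_constant_eve[OF f]
    by (intro nn_integral_cong)
      (simp add: space_uniform_count_measure prob_space.emeasure_space_1 encoder_message_law(1)[OF f])
  also have "\<dots> = (\<integral>\<^sup>+x. ennreal (\<Sum>i<n. (x i - \<mu>)\<^sup>2) \<partial>source \<mu> \<sigma> n)"
    by (simp add: U.emeasure_space_1 power2_commute)
  also have "\<dots> = ennreal (real n * \<sigma>\<^sup>2)"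
    using \<open>\<sigma> > 0\<close> unfolding source_eq_gauss by (rule nn_integral_gauss_sum_squares)
  finally have eve: "eve_distortion \<mu> \<sigma> Rs n f (constant_eve (\<lambda>_ _. \<mu>)) = ennreal (real n * \<sigma>\<^sup>2)" .
  have eq: "real n * \<sigma>\<^sup>2 - real n * \<sigma>\<^sup>2 * (1 - 2 powr (- 2 * R)) = real n * (\<sigma>\<^sup>2 * 2 powr (- 2 * R))"
    by (simp add: algebra_simps)
  show "\<exists>b a. 0 \<le> a \<and> 0 \<le> a - real n * \<sigma>\<^sup>2 * (1 - 2 powr (- 2 * R))
      \<and> eve_distortion \<mu> \<sigma> Rs n f (constant_eve b) = ennreal a
      \<and> ennreal (a - real n * \<sigma>\<^sup>2 * (1 - 2 powr (- 2 * R))) \<le> bob_distortion \<mu> \<sigma> Rs n f g"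
  proof (intro exI[of _ "\<lambda>_ _. \<mu>"] exI[of _ "real n * \<sigma>\<^sup>2"] conjI)
    show "0 \<le> real n * \<sigma>\<^sup>2 - real n * \<sigma>\<^sup>2 * (1 - 2 powr (- 2 * R))"
      unfolding eq by simp
    show "ennreal (real n * \<sigma>\<^sup>2 - real n * \<sigma>\<^sup>2 * (1 - 2 powr (- 2 * R))) \<le> bob_distortion \<mu> \<sigma> Rs n f g"
      unfolding eq by (rule bob_distortion_lower_bound[OF assms(1-3) f g])
  qed (use eve in auto)
qed

lemma converse_no_key:
  assumes "\<sigma> > 0" "R \<ge> 0" "n > 0"
  shows "secrecy_value \<mu> \<sigma> R 0 n \<le> ereal 0"
proof (rule secrecy_value_le[OF assms(1) order_refl assms(3)])
  fix f g assume f: "f \<in> encoders R 0 n" and g: "g \<in> bob_decoders R 0 n"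
  let ?IM = "index_set n R" and ?b = "bob_mean g 1"
  \<comment> \<open>Key rate zero leaves the single key 1 at every block length, so Eve knows which
    of Bob's kernels is in force.\<close>
  have IK: "index_set n 0 = {1}" by (auto simp: index_set_def)
  interpret U: prob_space "uniform_count_measure (index_set n 0)"
    by (rule prob_space_uniform_index) simp
  interpret S: prob_space "source \<mu> \<sigma> n" by (rule prob_space_source) fact
  have eve_le_bob: "eve_distortion \<mu> \<sigma> 0 n f (constant_eve ?b) \<le> bob_distortion \<mu> \<sigma> 0 n f g"
    unfolding eve_distortion_constant_eve[OF f] bob_distortion_def
    using bob_mean_minimizes[OF g] encoder_message_law(2)[OF f]
    by (intro nn_integral_mono) (simp add: space_uniform_count_measure IK)
  \<comment> \<open>Eve's distortion must be finite before it is subtracted. Summing over the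
    finitely many messages gives a crude bound on all reproduction vectors at once.\<close>
  define C where "C = (\<Sum>m\<in>?IM. \<Sum>i<n. 2 * (?b m i - \<mu>)\<^sup>2)"
  have "C \<ge> 0" by (simp add: C_def sum_nonneg)
  have "eve_distortion \<mu> \<sigma> 0 n f (constant_eve ?b)
      \<le> (\<integral>\<^sup>+x. \<integral>\<^sup>+k. ennreal C + 2 * ennreal (\<Sum>i<n. (x i - \<mu>)\<^sup>2) \<partial>uniform_count_measure (index_set n 0) \<partial>source \<mu> \<sigma> n)"
    unfolding eve_distortion_constant_eve[OF f]
  proof (intro nn_integral_mono)
    fix x k assume "x \<in> space (source \<mu> \<sigma> n)" "k \<in> space (uniform_count_measure (index_set n 0))"
    then have x: "x \<in> space (block n)" and k: "k \<in> index_set n 0" by (auto simp: space_uniform_count_measure)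
    interpret prob_space "f (x, k)" by (rule encoder_message_law[OF f x k])
    have "(\<integral>\<^sup>+m. ennreal (\<Sum>i<n. (?b m i - x i)\<^sup>2) \<partial>f (x, k))
        \<le> (\<integral>\<^sup>+m. ennreal C + 2 * ennreal (\<Sum>i<n. (x i - \<mu>)\<^sup>2) \<partial>f (x, k))"
    proof (intro nn_integral_mono)
      fix m assume "m \<in> space (f (x, k))"
      then have m: "m \<in> ?IM" using encoder_message_law[OF f x k] by simp
      have sq: "(u - v)\<^sup>2 \<le> 2 * (u - \<mu>)\<^sup>2 + 2 * (v - \<mu>)\<^sup>2" for u v :: real
        using zero_le_power2[of "(u - \<mu>) + (v - \<mu>)"] by (simp add: power2_eq_square algebra_simps)
      have "(\<Sum>i<n. (?b m i - x i)\<^sup>2) \<le> (\<Sum>i<n. 2 * (?b m i - \<mu>)\<^sup>2 + 2 * (x i - \<mu>)\<^sup>2)"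
        by (intro sum_mono sq)
      also have "\<dots> = (\<Sum>i<n. 2 * (?b m i - \<mu>)\<^sup>2) + 2 * (\<Sum>i<n. (x i - \<mu>)\<^sup>2)"
        by (simp add: sum.distrib sum_distrib_left)
      also have "(\<Sum>i<n. 2 * (?b m i - \<mu>)\<^sup>2) \<le> C"
        unfolding C_def using m by (intro member_le_sum) (auto intro!: sum_nonneg)
      finally have "ennreal (\<Sum>i<n. (?b m i - x i)\<^sup>2) \<le> ennreal (C + 2 * (\<Sum>i<n. (x i - \<mu>)\<^sup>2))"
        by (intro ennreal_leI) simp
      also have "\<dots> = ennreal C + 2 * ennreal (\<Sum>i<n. (x i - \<mu>)\<^sup>2)"
        using \<open>C \<ge> 0\<close> by (simp add: sum_nonneg ennreal_mult)
      finally show "ennreal (\<Sum>i<n. (?b m i - x i)\<^sup>2) \<le> \<dots>" .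
    qed
    then show "(\<integral>\<^sup>+m. ennreal (\<Sum>i<n. (?b m i - x i)\<^sup>2) \<partial>f (x, k))
        \<le> ennreal C + 2 * ennreal (\<Sum>i<n. (x i - \<mu>)\<^sup>2)" by (simp add: emeasure_space_1)
  qed
  also have "\<dots> = (\<integral>\<^sup>+x. ennreal C + 2 * ennreal (\<Sum>i<n. (x i - \<mu>)\<^sup>2) \<partial>source \<mu> \<sigma> n)"
    by (simp add: U.emeasure_space_1)
  also have "\<dots> = ennreal C + 2 * ennreal (real n * \<sigma>\<^sup>2)"
    using nn_integral_gauss_sum_squares[OF \<open>\<sigma> > 0\<close>, of "\<lambda>_. \<mu>" n]
    by (simp add: nn_integral_add nn_integral_cmult S.emeasure_space_1[simplified] source_eq_gauss[symmetric])
  also have "\<dots> < \<infinity>" by (simp add: ennreal_mult_less_top)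
  finally obtain a where "0 \<le> a" "eve_distortion \<mu> \<sigma> 0 n f (constant_eve ?b) = ennreal a"
    by (cases "eve_distortion \<mu> \<sigma> 0 n f (constant_eve ?b)") auto
  then show "\<exists>b a. 0 \<le> a \<and> 0 \<le> a - real n * \<sigma>\<^sup>2 * 0
      \<and> eve_distortion \<mu> \<sigma> 0 n f (constant_eve b) = ennreal a
      \<and> ennreal (a - real n * \<sigma>\<^sup>2 * 0) \<le> bob_distortion \<mu> \<sigma> 0 n f g"
    using eve_le_bob by (intro exI[of _ ?b] exI[of _ a]) simp
qed

subsection \<open>Achievability by sign flips\<close>

definition key_sign :: "nat \<Rightarrow> real" where
  "key_sign k = (if odd k then 1 else - 1)"

lemma key_sign_square: "(key_sign k)\<^sup>2 = 1" "key_sign k * key_sign k = 1" "key_sign k \<noteq> 0" "\<bar>key_sign k\<bar> = 1"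
  by (auto simp: key_sign_def)

lemma sum_key_sign: "(\<Sum>k=1..K. key_sign k) = (if odd K then 1 else 0)"
  by (induction K) (auto simp: key_sign_def)

text \<open>With s the mean sign, the average over the keys of (v - sign * u)^2 equals (v - s u)^2 +
  (1 - s^2) u^2. Alternating signs starting at key 1 sum to 0 or 1, so |s| is at most 1/K.\<close>

lemma mean_square_key_sign:
  fixes v u :: "nat \<Rightarrow> real"
  assumes "K > 0"
  shows "(1 - 1 / (real K)\<^sup>2) * (\<Sum>i<n. (u i)\<^sup>2)
    \<le> 1 / real K * (\<Sum>k=1..K. \<Sum>i<n. (v i - key_sign k * u i)\<^sup>2)"
proof -
  define s where "s = (\<Sum>k=1..K. key_sign k) / real K"
  have "(\<Sum>k=1..K. key_sign k)\<^sup>2 \<le> 1" unfolding sum_key_sign by simp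
  then have s: "s\<^sup>2 \<le> 1 / (real K)\<^sup>2" by (simp add: s_def power_divide divide_right_mono)
  have "(1 - 1 / (real K)\<^sup>2) * (u i)\<^sup>2 \<le> 1 / real K * (\<Sum>k=1..K. (v i - key_sign k * u i)\<^sup>2)" for i
  proof -
    have "(v i - key_sign k * u i)\<^sup>2 = (v i)\<^sup>2 + (u i)\<^sup>2 - 2 * v i * u i * key_sign k" for k
      by (simp add: power2_diff power_mult_distrib key_sign_square)
    then have "(\<Sum>k=1..K. (v i - key_sign k * u i)\<^sup>2)
        = real K * ((v i)\<^sup>2 + (u i)\<^sup>2) - 2 * v i * u i * (\<Sum>k=1..K. key_sign k)"
      by (simp add: sum_subtractf sum_distrib_left)
    then have "1 / real K * (\<Sum>k=1..K. (v i - key_sign k * u i)\<^sup>2) = (v i)\<^sup>2 + (u i)\<^sup>2 - 2 * v i * u i * s"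
      using assms by (simp add: s_def field_simps)
    moreover have "0 \<le> (v i - s * u i)\<^sup>2" by simp
    moreover have "s\<^sup>2 * (u i)\<^sup>2 \<le> 1 / (real K)\<^sup>2 * (u i)\<^sup>2" by (intro mult_right_mono s) simp
    ultimately show ?thesis by (simp add: power2_eq_square algebra_simps)
  qed
  then have "(\<Sum>i<n. (1 - 1 / (real K)\<^sup>2) * (u i)\<^sup>2) \<le> (\<Sum>i<n. 1 / real K * (\<Sum>k=1..K. (v i - key_sign k * u i)\<^sup>2))"
    by (rule sum_mono)
  also have "\<dots> = 1 / real K * (\<Sum>k=1..K. \<Sum>i<n. (v i - key_sign k * u i)\<^sup>2)"
    by (subst sum.swap) (simp add: sum_distrib_left)
  finally show ?thesis by (simp add: sum_distrib_left)
qed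

text \<open>Centring, scaling and flipping in the shape b + a x of the affine lemma; the restriction
  keeps the result in the space of \<open>block n\<close>.\<close>

definition whiten :: "real \<Rightarrow> real \<Rightarrow> nat \<Rightarrow> nat \<Rightarrow> (nat \<Rightarrow> real) \<Rightarrow> nat \<Rightarrow> real" where
  "whiten \<mu> \<sigma> n k x = (\<lambda>i\<in>{..<n}. - (key_sign k * \<mu> / \<sigma>) + key_sign k / \<sigma> * x i)"

lemma whiten_inverse:
  assumes "\<sigma> > 0" "i < n"
  shows "x i = \<mu> + \<sigma> * (key_sign k * whiten \<mu> \<sigma> n k x i)"
proof -
  have "key_sign k * (- (key_sign k * \<mu> / \<sigma>) + key_sign k / \<sigma> * x i)
      = (key_sign k * key_sign k) * ((x i - \<mu>) / \<sigma>)"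
    by (simp add: algebra_simps diff_divide_distrib)
  then show ?thesis using assms by (simp add: whiten_def key_sign_square)
qed

lemma measurable_whiten [measurable]: "whiten \<mu> \<sigma> n k \<in> block n \<rightarrow>\<^sub>M block n"
  unfolding whiten_def[abs_def] by measurable

text \<open>The right side is free of \<open>k\<close>: this is the independence of whitened source
  and key, in the form in which it is used.\<close>

lemma nn_integral_whiten:
  assumes "\<sigma> > 0" "H \<in> borel_measurable (block n)"
  shows "(\<integral>\<^sup>+x. H (whiten \<mu> \<sigma> n k x) \<partial>source \<mu> \<sigma> n) = (\<integral>\<^sup>+x. H x \<partial>gauss (\<lambda>_. 0) 1 n)"
  using nn_integral_gauss_affine[of \<sigma> "key_sign k / \<sigma>" H n \<mu> "- (key_sign k * \<mu> / \<sigma>)"] assms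
  by (simp add: source_eq_gauss whiten_def key_sign_square)

definition sign_encoder ::
    "real \<Rightarrow> real \<Rightarrow> real \<Rightarrow> nat \<Rightarrow> ((nat \<Rightarrow> real) \<Rightarrow> nat) \<Rightarrow> (nat \<Rightarrow> real) \<times> nat \<Rightarrow> nat measure" where
  "sign_encoder \<mu> \<sigma> R n q = (\<lambda>(x, k). return (count_space (index_set n R)) (q (whiten \<mu> \<sigma> n k x)))"

definition sign_decoder ::
    "real \<Rightarrow> real \<Rightarrow> (nat \<Rightarrow> nat \<Rightarrow> real) \<Rightarrow> nat \<Rightarrow> nat \<times> nat \<Rightarrow> real measure" where
  "sign_decoder \<mu> \<sigma> c i = (\<lambda>(m, k). return borel (\<mu> + \<sigma> * (key_sign k * c m i)))"

lemma sign_encoder_in_encoders: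
  assumes [measurable]: "q \<in> block n \<rightarrow>\<^sub>M count_space (index_set n R)"
  shows "sign_encoder \<mu> \<sigma> R n q \<in> encoders R Rs n"
proof -
  have [measurable]: "key_sign \<in> count_space (index_set n Rs) \<rightarrow>\<^sub>M borel" by simp
  have [measurable]: "(\<lambda>(x, k). whiten \<mu> \<sigma> n k x) \<in> block n \<Otimes>\<^sub>M count_space (index_set n Rs) \<rightarrow>\<^sub>M block n"
    unfolding whiten_def by measurable
  show ?thesis unfolding encoders_def sign_encoder_def by measurable
qed

lemma sign_decoder_in_bob_decoders: "sign_decoder \<mu> \<sigma> c \<in> bob_decoders R Rs n"
  unfolding bob_decoders_def sign_decoder_def
proof (intro CollectI allI impI)
  fix i
  have [measurable]: "(\<lambda>m. c m i) \<in> count_space (index_set n R) \<rightarrow>\<^sub>M borel"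
    "key_sign \<in> count_space (index_set n Rs) \<rightarrow>\<^sub>M borel" by simp_all
  show "(\<lambda>(m, k). return borel (\<mu> + \<sigma> * (key_sign k * c m i)))
      \<in> count_space (index_set n R) \<Otimes>\<^sub>M count_space (index_set n Rs) \<rightarrow>\<^sub>M prob_algebra borel"
    by measurable
qed

lemma nn_integral_sign_encoder:
  assumes "q \<in> block n \<rightarrow>\<^sub>M count_space (index_set n R)" "x \<in> space (block n)"
  shows "(\<integral>\<^sup>+m. h m \<partial>sign_encoder \<mu> \<sigma> R n q (x, k)) = h (q (whiten \<mu> \<sigma> n k x))"
proof -
  have "q (whiten \<mu> \<sigma> n k x) \<in> index_set n R"
    using measurable_space[OF assms(1) measurable_space[OF measurable_whiten assms(2)]] by simp
  then show ?thesis by (simp add: sign_encoder_def nn_integral_return)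
qed

text \<open>Undoing the flip is an isometry and undoing the scaling multiplies squared errors by the
  variance, so every key yields the same scaled distortion of the underlying code.\<close>

lemma bob_distortion_sign_code:
  assumes "\<sigma> > 0" "Rs \<ge> 0" and q: "q \<in> block n \<rightarrow>\<^sub>M count_space (index_set n R)"
  shows "bob_distortion \<mu> \<sigma> Rs n (sign_encoder \<mu> \<sigma> R n q) (sign_decoder \<mu> \<sigma> c)
    = ennreal (\<sigma>\<^sup>2) * (\<integral>\<^sup>+w. ennreal (\<Sum>i<n. (w i - c (q w) i)\<^sup>2) \<partial>gauss (\<lambda>_. 0) 1 n)"
proof -
  let ?IK = "index_set n Rs" and ?G = "gauss (\<lambda>_. 0) 1 n"
  have "?IK \<noteq> {}" using index_set_nonempty[OF \<open>Rs \<ge> 0\<close>] by blast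
  then have card: "card ?IK > 0" by (simp add: card_gt_0_iff)
  let ?h = "\<lambda>w. ennreal (\<Sum>i<n. (w i - c (q w) i)\<^sup>2)"
  have h [measurable]: "?h \<in> borel_measurable (block n)"
  proof -
    have [measurable]: "(\<lambda>w. c (q w) i) \<in> borel_measurable (block n)" for i
      by (rule measurable_compose[OF q]) simp
    show ?thesis by measurable
  qed
  have "(\<Sum>i<n. \<integral>\<^sup>+y. ennreal ((y - x i)\<^sup>2) \<partial>sign_decoder \<mu> \<sigma> c i (q (whiten \<mu> \<sigma> n k x), k))
      = ennreal (\<sigma>\<^sup>2) * ?h (whiten \<mu> \<sigma> n k x)" for x k
  proof -
    let ?w = "whiten \<mu> \<sigma> n k x"
    have "(\<Sum>i<n. \<integral>\<^sup>+y. ennreal ((y - x i)\<^sup>2) \<partial>sign_decoder \<mu> \<sigma> c i (q ?w, k))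
        = (\<Sum>i<n. ennreal (\<sigma>\<^sup>2 * (?w i - c (q ?w) i)\<^sup>2))"
    proof (intro sum.cong refl)
      fix i assume "i \<in> {..<n}"
      then have x: "x i = \<mu> + \<sigma> * (key_sign k * ?w i)" using whiten_inverse[OF \<open>\<sigma> > 0\<close>] by simp
      have "(\<integral>\<^sup>+y. ennreal ((y - x i)\<^sup>2) \<partial>sign_decoder \<mu> \<sigma> c i (q ?w, k))
          = ennreal ((\<mu> + \<sigma> * (key_sign k * c (q ?w) i) - x i)\<^sup>2)"
        by (simp add: sign_decoder_def nn_integral_return)
      also have "\<mu> + \<sigma> * (key_sign k * c (q ?w) i) - x i = - (\<sigma> * (key_sign k * (?w i - c (q ?w) i)))"
        by (subst x) (simp add: algebra_simps)
      also have "(- (\<sigma> * (key_sign k * (?w i - c (q ?w) i))))\<^sup>2 = \<sigma>\<^sup>2 * (?w i - c (q ?w) i)\<^sup>2"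
        by (simp add: power_mult_distrib key_sign_square)
      finally show "(\<integral>\<^sup>+y. ennreal ((y - x i)\<^sup>2) \<partial>sign_decoder \<mu> \<sigma> c i (q ?w, k))
        = ennreal (\<sigma>\<^sup>2 * (?w i - c (q ?w) i)\<^sup>2)" .
    qed
    then show ?thesis by (simp add: sum_ennreal sum_nonneg flip: sum_distrib_left ennreal_mult)
  qed
  then have "bob_distortion \<mu> \<sigma> Rs n (sign_encoder \<mu> \<sigma> R n q) (sign_decoder \<mu> \<sigma> c)
      = (\<integral>\<^sup>+x. ennreal (1 / real (card ?IK)) * (\<Sum>k\<in>?IK. ennreal (\<sigma>\<^sup>2) * ?h (whiten \<mu> \<sigma> n k x)) \<partial>source \<mu> \<sigma> n)"
    unfolding bob_distortion_def nn_integral_uniform_index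
    by (intro nn_integral_cong) (simp add: nn_integral_sign_encoder[OF q])
  also have "\<dots> = ennreal (1 / real (card ?IK))
      * (\<Sum>k\<in>?IK. ennreal (\<sigma>\<^sup>2) * (\<integral>\<^sup>+x. ?h (whiten \<mu> \<sigma> n k x) \<partial>source \<mu> \<sigma> n))"
  proof -
    have [measurable]: "(\<lambda>x. ?h (whiten \<mu> \<sigma> n k x)) \<in> borel_measurable (block n)" for k
      by (rule measurable_compose[OF measurable_whiten h])
    show ?thesis by (simp add: nn_integral_cmult nn_integral_sum)
  qed
  also have "\<dots> = ennreal (1 / real (card ?IK)) * (\<Sum>k\<in>?IK. ennreal (\<sigma>\<^sup>2) * (\<integral>\<^sup>+w. ?h w \<partial>?G))"
    unfolding nn_integral_whiten[OF \<open>\<sigma> > 0\<close> h] ..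
  also have "\<dots> = ennreal (\<sigma>\<^sup>2) * (\<integral>\<^sup>+w. ?h w \<partial>?G)"
    using card \<open>?IK \<noteq> {}\<close>
    by (simp add: ennreal_of_nat_eq_real_of_nat mult.assoc[symmetric] flip: ennreal_mult)
  finally show ?thesis .
qed

text \<open>
  The whitened source is independent of the key, so the message reveals nothing about the sign;
  whatever Eve outputs, averaging over the sign costs her at least the full source variance,
  up to the parity defect of an odd number of keys.
\<close>

lemma eve_distortion_sign_code:
  assumes "\<sigma> > 0" "Rs \<ge> 0" and q: "q \<in> block n \<rightarrow>\<^sub>M count_space (index_set n R)"
    and t: "t \<in> weak_eve_decoders R n"
  shows "ennreal ((1 - 1 / (real (card (index_set n Rs)))\<^sup>2) * (real n * \<sigma>\<^sup>2))
    \<le> eve_distortion \<mu> \<sigma> Rs n (sign_encoder \<mu> \<sigma> R n q) t"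
proof -
  let ?IK = "index_set n Rs" and ?G = "gauss (\<lambda>_. 0) 1 n"
  define K where "K = card ?IK"
  have IK: "?IK = {1..K}" by (simp add: K_def index_set_eq)
  have "?IK \<noteq> {}" using index_set_nonempty[OF \<open>Rs \<ge> 0\<close>] by blast
  then have "K > 0" by (simp add: K_def card_gt_0_iff)
  let ?E = "\<lambda>w. eve_outputs t (q w) n"
  \<comment> \<open>The source letter is written through the whitened w. Eve's output law depends on
    w only through \<open>q w\<close>, so for fixed w and z the key can be averaged under her
    integral.\<close>
  define h where "h k w z = (\<Sum>i<n. (z i - (\<mu> + \<sigma> * (key_sign k * w i)))\<^sup>2)" for k and w z :: "nat \<Rightarrow> real"
  define \<Psi> where "\<Psi> k w = (\<integral>\<^sup>+z. ennreal (h k w z) \<partial>?E w)" for k w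
  have E_prob: "?E w \<in> space (prob_algebra (block n))" if "w \<in> space (block n)" for w
    using measurable_space[OF q that] by (intro eve_outputs_in_prob_algebra[OF t]) auto
  have [measurable]: "?E \<in> block n \<rightarrow>\<^sub>M prob_algebra (block n)"
    by (rule measurable_compose[OF q, of "\<lambda>m. eve_outputs t m n"])
      (auto intro!: eve_outputs_in_prob_algebra[OF t])
  have \<Psi> [measurable]: "\<Psi> k \<in> borel_measurable (block n)" for k
    unfolding \<Psi>_def[abs_def]
  proof (rule nn_integral_measurable_subprob_algebra2)
    show "(\<lambda>(w, z). ennreal (h k w z)) \<in> borel_measurable (block n \<Otimes>\<^sub>M block n)"
      unfolding h_def by measurable
    show "?E \<in> block n \<rightarrow>\<^sub>M subprob_algebra (block n)"
      by (rule measurable_prob_algebraD) measurable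
  qed
  have pointwise: "\<sigma>\<^sup>2 * (1 - 1 / (real K)\<^sup>2) * (\<Sum>i<n. (w i)\<^sup>2) \<le> 1 / real K * (\<Sum>k=1..K. h k w z)" for w z
  proof -
    have "h k w z = (\<Sum>i<n. ((z i - \<mu>) - key_sign k * (\<sigma> * w i))\<^sup>2)" for k
      unfolding h_def by (intro sum.cong refl) (simp add: algebra_simps)
    then show ?thesis
      using mean_square_key_sign[OF \<open>K > 0\<close>, of "\<lambda>i. \<sigma> * w i" n "\<lambda>i. z i - \<mu>"]
      by (simp add: power_mult_distrib mult_ac flip: sum_distrib_left)
  qed
  have "(1 / real K)\<^sup>2 \<le> 1" using \<open>K > 0\<close> by (simp add: power_le_one)
  then have K1: "0 \<le> 1 - 1 / (real K)\<^sup>2" by (simp add: power_divide)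
  have "ennreal ((1 - 1 / (real K)\<^sup>2) * (real n * \<sigma>\<^sup>2))
      = ennreal (\<sigma>\<^sup>2 * (1 - 1 / (real K)\<^sup>2)) * (\<integral>\<^sup>+w. ennreal (\<Sum>i<n. (w i)\<^sup>2) \<partial>?G)"
    using nn_integral_gauss_sum_squares[of 1 "\<lambda>_. 0" n] K1 by (simp add: mult_ac flip: ennreal_mult)
  also have "\<dots> = (\<integral>\<^sup>+w. ennreal (\<sigma>\<^sup>2 * (1 - 1 / (real K)\<^sup>2) * (\<Sum>i<n. (w i)\<^sup>2)) \<partial>?G)"
    using K1 by (subst nn_integral_cmult[symmetric]) (auto intro!: nn_integral_cong simp: sum_nonneg ennreal_mult)
  also have "\<dots> \<le> (\<integral>\<^sup>+w. ennreal (1 / real K) * (\<Sum>k=1..K. \<Psi> k w) \<partial>?G)"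
  proof (intro nn_integral_mono)
    fix w assume "w \<in> space ?G"
    then have w: "w \<in> space (block n)" by simp
    have "prob_space (?E w)" and [measurable_cong]: "sets (?E w) = sets (block n)"
      using E_prob[OF w] by (auto simp: space_prob_algebra)
    then interpret prob_space "?E w" by simp
    have [measurable]: "(\<lambda>z. h k w z) \<in> borel_measurable (?E w)" for k
      unfolding h_def by measurable
    have h_nonneg: "0 \<le> h k w z" for k z by (simp add: h_def sum_nonneg)
    have "ennreal (\<sigma>\<^sup>2 * (1 - 1 / (real K)\<^sup>2) * (\<Sum>i<n. (w i)\<^sup>2))
        = (\<integral>\<^sup>+z. ennreal (\<sigma>\<^sup>2 * (1 - 1 / (real K)\<^sup>2) * (\<Sum>i<n. (w i)\<^sup>2)) \<partial>?E w)"
      by (simp add: emeasure_space_1)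
    also have "\<dots> \<le> (\<integral>\<^sup>+z. ennreal (1 / real K * (\<Sum>k=1..K. h k w z)) \<partial>?E w)"
      by (intro nn_integral_mono ennreal_leI pointwise)
    also have "\<dots> = (\<integral>\<^sup>+z. ennreal (1 / real K) * (\<Sum>k=1..K. ennreal (h k w z)) \<partial>?E w)"
      using h_nonneg by (intro nn_integral_cong) (simp add: sum_ennreal sum_nonneg flip: ennreal_mult)
    also have "\<dots> = ennreal (1 / real K) * (\<Sum>k=1..K. \<Psi> k w)"
      unfolding \<Psi>_def by (simp add: nn_integral_cmult nn_integral_sum)
    finally show "ennreal (\<sigma>\<^sup>2 * (1 - 1 / (real K)\<^sup>2) * (\<Sum>i<n. (w i)\<^sup>2))
      \<le> ennreal (1 / real K) * (\<Sum>k=1..K. \<Psi> k w)" .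
  qed
  also have "\<dots> = ennreal (1 / real K) * (\<Sum>k=1..K. \<integral>\<^sup>+w. \<Psi> k w \<partial>?G)"
    by (simp add: nn_integral_cmult nn_integral_sum)
  \<comment> \<open>The change back from whitened to true source is made separately for each key,
    each with its own flip.\<close>
  also have "\<dots> = ennreal (1 / real K) * (\<Sum>k=1..K. \<integral>\<^sup>+x. \<Psi> k (whiten \<mu> \<sigma> n k x) \<partial>source \<mu> \<sigma> n)"
    by (simp add: nn_integral_whiten[OF \<open>\<sigma> > 0\<close> \<Psi>])
  also have "\<dots> = (\<integral>\<^sup>+x. ennreal (1 / real K) * (\<Sum>k=1..K. \<Psi> k (whiten \<mu> \<sigma> n k x)) \<partial>source \<mu> \<sigma> n)"
  proof -
    have [measurable]: "(\<lambda>x. \<Psi> k (whiten \<mu> \<sigma> n k x)) \<in> borel_measurable (block n)" for k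
      by (rule measurable_compose[OF measurable_whiten \<Psi>])
    show ?thesis by (simp add: nn_integral_cmult nn_integral_sum)
  qed
  also have "\<dots> = eve_distortion \<mu> \<sigma> Rs n (sign_encoder \<mu> \<sigma> R n q) t"
    unfolding eve_distortion_def nn_integral_uniform_index
  proof (intro nn_integral_cong)
    fix x assume "x \<in> space (source \<mu> \<sigma> n)"
    then have x: "x \<in> space (block n)" by simp
    have "h k (whiten \<mu> \<sigma> n k x) z = (\<Sum>i<n. (z i - x i)\<^sup>2)" for k z
      unfolding h_def using whiten_inverse[OF \<open>\<sigma> > 0\<close>, of _ n x \<mu> k] by (intro sum.cong refl) simp
    then show "ennreal (1 / real K) * (\<Sum>k=1..K. \<Psi> k (whiten \<mu> \<sigma> n k x))
      = ennreal (1 / real (card ?IK)) * (\<Sum>k\<in>?IK. \<integral>\<^sup>+m. \<integral>\<^sup>+z. ennreal (\<Sum>i<n. (z i - x i)\<^sup>2)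
          \<partial>eve_outputs t m n \<partial>sign_encoder \<mu> \<sigma> R n q (x, k))"
      by (simp add: nn_integral_sign_encoder[OF q x] \<Psi>_def IK)
  qed
  finally show ?thesis by (simp add: K_def)
qed

lemma achievability:
  assumes "\<sigma> > 0" "Rs > 0" "R \<ge> 0" "\<epsilon> > 0"
  shows "eventually (\<lambda>n. ereal (1 - 2 powr (- 2 * R) - \<epsilon>) \<le> secrecy_value \<mu> \<sigma> R Rs n) sequentially"
proof -
  have "(\<lambda>n. 1 / (real (card (index_set n Rs)))\<^sup>2) \<longlonglongrightarrow> 0"
  proof -
    have "filterlim (\<lambda>n. 2 powr (real n * Rs) - 1) at_top sequentially"
      using \<open>Rs > 0\<close> by real_asymp
    then have "filterlim (\<lambda>n. real (card (index_set n Rs))) at_top sequentially"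
      by (rule filterlim_at_top_mono) (auto intro!: always_eventually simp: index_set_eq)
    from tendsto_power[OF tendsto_inverse_0_at_top[OF this], of 2]
    show ?thesis by (simp add: power_one_over inverse_eq_divide)
  qed
  \<comment> \<open>One half of \<epsilon> pays for the parity defect, the other for the Gaussian
    code.\<close>
  then have "eventually (\<lambda>n. 1 / (real (card (index_set n Rs)))\<^sup>2 < \<epsilon> / 2) sequentially"
    using \<open>\<epsilon> > 0\<close> by (intro order_tendstoD) auto
  moreover have "\<epsilon> / 2 > 0" using \<open>\<epsilon> > 0\<close> by simp
  note gaussian_code_asymptotic[OF \<open>R \<ge> 0\<close> this]
  ultimately show ?thesis using eventually_gt_at_top[of 0]
  proof eventually_elim
    case (elim n)
    then obtain c q where q: "q \<in> block n \<rightarrow>\<^sub>M count_space (index_set n R)"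
      and code: "(\<integral>\<^sup>+x. ennreal (\<Sum>i<n. (x i - c (q x) i)\<^sup>2) \<partial>gauss (\<lambda>_. 0) 1 n)
        \<le> ennreal (real n * (2 powr (- 2 * R) + \<epsilon> / 2))" by blast
    let ?f = "sign_encoder \<mu> \<sigma> R n q" and ?g = "sign_decoder \<mu> \<sigma> c" and ?c = "1 / (real n * \<sigma>\<^sup>2)"
    let ?B = "\<sigma>\<^sup>2 * (real n * (2 powr (- 2 * R) + \<epsilon> / 2))"
    let ?A = "(1 - 1 / (real (card (index_set n Rs)))\<^sup>2) * (real n * \<sigma>\<^sup>2)"
    note f = sign_encoder_in_encoders[OF q, of \<mu> \<sigma> Rs] and g = sign_decoder_in_bob_decoders[of \<mu> \<sigma> c R Rs n]
    have c: "?c > 0" using assms elim by simp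
    have B: "bob_distortion \<mu> \<sigma> Rs n ?f ?g \<le> ennreal ?B"
      using assms code by (subst bob_distortion_sign_code[OF _ _ q]) (auto simp: ennreal_mult' mult_left_mono)
    have "ereal (1 - 2 powr (- 2 * R) - \<epsilon>)
        \<le> expectation_ereal (joint_law \<mu> \<sigma> Rs n ?f ?g t) (block_payoff \<sigma> n)"
      if t: "t \<in> weak_eve_decoders R n" for t
    proof -
      have A: "ennreal ?A \<le> eve_distortion \<mu> \<sigma> Rs n ?f t"
        using assms by (intro eve_distortion_sign_code[OF _ _ q t]) auto
      have "bob_distortion \<mu> \<sigma> Rs n ?f ?g \<noteq> \<infinity>" using B by (auto simp: top_unique)
      then have val: "expectation_ereal (joint_law \<mu> \<sigma> Rs n ?f ?g t) (block_payoff \<sigma> n)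
          = enn2ereal (ennreal ?c * eve_distortion \<mu> \<sigma> Rs n ?f t) - enn2ereal (ennreal ?c * bob_distortion \<mu> \<sigma> Rs n ?f ?g)"
        using assms elim by (intro expectation_block_payoff[OF _ _ _ f g t]) auto
      have "?c * ?A = 1 - 1 / (real (card (index_set n Rs)))\<^sup>2" "?c * ?B = 2 powr (- 2 * R) + \<epsilon> / 2"
        using assms elim by simp_all
      with elim(1) have "1 - 2 powr (- 2 * R) - \<epsilon> \<le> ?c * ?A - ?c * ?B" by simp
      then have "ereal (1 - 2 powr (- 2 * R) - \<epsilon>) \<le> ereal (?c * ?A) - ereal (?c * ?B)" by simp
      also have "\<dots> \<le> enn2ereal (ennreal ?c * ennreal ?A) - enn2ereal (ennreal ?c * ennreal ?B)"
      proof (intro ereal_minus_mono)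
        \<comment> \<open>Conversion to \<open>ennreal\<close> truncates negative reals to 0, so
          this direction holds for any sign of \<open>?c * ?A\<close>.\<close>
        have "ereal u \<le> enn2ereal (ennreal u)" for u
          by (cases "0 \<le> u") (auto simp: enn2ereal_ennreal ennreal_neg zero_ennreal.rep_eq)
        then show "ereal (?c * ?A) \<le> enn2ereal (ennreal ?c * ennreal ?A)"
          unfolding ennreal_mult'[OF less_imp_le[OF c], symmetric] .
        have "0 \<le> ?c * ?B" using assms by simp
        then show "enn2ereal (ennreal ?c * ennreal ?B) \<le> ereal (?c * ?B)"
          unfolding ennreal_mult'[OF less_imp_le[OF c], symmetric] by (subst enn2ereal_ennreal) auto
      qed
      also have "\<dots> \<le> enn2ereal (ennreal ?c * eve_distortion \<mu> \<sigma> Rs n ?f t) - enn2ereal (ennreal ?c * bob_distortion \<mu> \<sigma> Rs n ?f ?g)"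
        using A B by (intro ereal_minus_mono) (simp_all add: less_eq_ennreal.rep_eq[symmetric] mult_left_mono)
      finally show ?thesis unfolding val .
    qed
    then show ?case
      unfolding secrecy_value_def
      using f g by (intro SUP_upper2[of "(?f, ?g)"]) (auto intro!: INF_greatest)
  qed
qed

text \<open>The last hypothesis excludes exactly the case of no key and \<open>p \<le> 0\<close>.
  There the payoff is achievable: with a constant message and Bob answering the source mean, Eve can
  do no better than the mean herself, so the value 0 is guaranteed although \<open>Rs > 0\<close>
  fails.\<close>

theorem theorem1:
  fixes \<mu>\<^sub>0 \<sigma>\<^sub>0 R Rs p :: real
  assumes "\<sigma>\<^sub>0 > 0" and "R \<ge> 0" and "Rs \<ge> 0"
    and "Rs > 0 \<or> p > 0"
  shows "achievable \<mu>\<^sub>0 \<sigma>\<^sub>0 R Rs p \<longleftrightarrow> Rs > 0 \<and> p \<le> 1 - 2 powr (- 2 * R)"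
proof (cases "Rs > 0")
  case True
  let ?L = "1 - 2 powr (- 2 * R)"
  have upper: "eventually (\<lambda>n. secrecy_value \<mu>\<^sub>0 \<sigma>\<^sub>0 R Rs n \<le> ereal ?L) sequentially"
    using eventually_gt_at_top[of 0] by eventually_elim (rule converse_rate[OF assms(1,3,2)])
  \<comment> \<open>Achievability demands a genuine limit. The upper bound holds for each positive n
    and the lower one up to any \<epsilon>, so the limit exists, and its uniqueness settles the
    existential in \<open>achievable\<close>.\<close>
  have "secrecy_value \<mu>\<^sub>0 \<sigma>\<^sub>0 R Rs \<longlonglongrightarrow> ereal ?L"
  proof (rule order_tendstoI)
    fix a assume "a < ereal ?L"
    then obtain r where r: "a < ereal r" "ereal r < ereal ?L" using ereal_dense2 by blast
    then have "?L - r > 0" by simp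
    from achievability[OF assms(1) True assms(2) this, of \<mu>\<^sub>0]
    show "eventually (\<lambda>n. a < secrecy_value \<mu>\<^sub>0 \<sigma>\<^sub>0 R Rs n) sequentially"
      by eventually_elim (use r(1) in \<open>simp add: less_le_trans\<close>)
  next
    fix a assume "ereal ?L < a"
    with upper show "eventually (\<lambda>n. secrecy_value \<mu>\<^sub>0 \<sigma>\<^sub>0 R Rs n < a) sequentially"
      by (auto elim: eventually_mono)
  qed
  then have "achievable \<mu>\<^sub>0 \<sigma>\<^sub>0 R Rs p \<longleftrightarrow> ereal p \<le> ereal ?L"
    unfolding achievable_def by (metis LIMSEQ_unique)
  with True show ?thesis by simp
next
  case False
  with assms have "Rs = 0" "p > 0" by auto
  have "\<not> achievable \<mu>\<^sub>0 \<sigma>\<^sub>0 R Rs p"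
  proof
    assume "achievable \<mu>\<^sub>0 \<sigma>\<^sub>0 R Rs p"
    then obtain l where l: "secrecy_value \<mu>\<^sub>0 \<sigma>\<^sub>0 R 0 \<longlonglongrightarrow> l" "ereal p \<le> l"
      by (auto simp: achievable_def \<open>Rs = 0\<close>)
    have "l \<le> ereal 0"
      using l(1) by (rule LIMSEQ_le_const2)
        (auto intro!: exI[of _ 1] converse_no_key[OF assms(1,2), simplified])
    with l(2) have "ereal p \<le> ereal 0" by (rule order_trans)
    with \<open>p > 0\<close> show False by simp
  qed
  with False show ?thesis by simp
qed

end
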